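(* Let $\beta>1$ be fixed. Then, as $n\to\infty$, $$\sigma_{\beta}(F_n)=\frac{1}{n^{\beta}}\frac{2\zeta(2\beta-1)}{\zeta(2\beta)}+\sum_{1\le k<2\beta-2}C_k\frac{1}{n^{\beta+k}}+\sum_{0\le k<\beta-2}C^{*}_k\frac{1}{n^{2\beta+k}}+O\!\left(\frac{\log^{3\beta}n}{n^{3\beta-2}}\right),$$ where $C_k=C_k(\beta)$ and $C^{*}_k=C^{*}_k(\beta)$ are positive constants depending only on $\beta$.
   Context: Brocot sequences $F_n\subset[0,1]$ are defined inductively: $F_1=\{0/1,1/1\}$; if the elements of $F_n$ in increasing order are $0=x_{0,n}<x_{1,n}<\dots<x_{N(n),n}=1$ with $N(n)=2^{n-1}$, then $F_{n+1}=F_n\cup\{x_{i-1,n}\oplus x_{i,n}: i=1,\dots,N(n)\}$, where $\frac{p}{q}\oplus\frac{p'}{q'}=\frac{p+p'}{q+q'}$ (mediant of fractions in lowest terms). Let $p_{i,n}=x_{i,n}-x_{i-1,n}$, $i=1,\dots,N(n)$, and $\sigma_\beta(F_n)=\sum_{i=1}^{N(n)}p_{i,n}^{\beta}$. $\zeta$ is the Riemann zeta function. The implied constant in $O$ depends only on $\beta$. *)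

theory Defs
  imports Complex_Main "HOL-Library.Landau_Symbols"
begin

text \<open>\<^const>\<open>quotient_of\<close> yields numerator and (positive) denominator in lowest terms.\<close>

definition mediant :: "rat \<Rightarrow> rat \<Rightarrow> rat" where
  "mediant x y =
     Fract (fst (quotient_of x) + fst (quotient_of y)) (snd (quotient_of x) + snd (quotient_of y))"

text \<open>The sequence starts at index 1; the value at index 0 is a dummy. The elements of the
  set at index \<open>n \<ge> 1\<close> in increasing order are \<open>sorted_list_of_set (brocot n) ! i\<close> for
  \<open>i = 0, \<dots>, 2 ^ (n - 1)\<close>.\<close>

fun brocot :: "nat \<Rightarrow> rat set" where
  "brocot 0 = {}"
| "brocot (Suc 0) = {0, 1}"
| "brocot (Suc (Suc n)) = brocot (Suc n) \<union>
     {mediant (sorted_list_of_set (brocot (Suc n)) ! (i - 1))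
              (sorted_list_of_set (brocot (Suc n)) ! i) | i. 1 \<le> i \<and> i \<le> 2 ^ n}"

definition brocot_elem :: "nat \<Rightarrow> nat \<Rightarrow> real" where
  "brocot_elem i n = of_rat (sorted_list_of_set (brocot n) ! i)"

definition brocot_gap :: "nat \<Rightarrow> nat \<Rightarrow> real" where
  "brocot_gap i n = brocot_elem i n - brocot_elem (i - 1) n"

definition brocot_sigma :: "real \<Rightarrow> nat \<Rightarrow> real" where
  "brocot_sigma \<beta> n = (\<Sum>i = 1..2 ^ (n - 1). brocot_gap i n powr \<beta>)"

text \<open>The Dirichlet series of the Riemann zeta function, to be used only for \<open>s > 1\<close>.\<close>

definition zeta :: "real \<Rightarrow> real" where
  "zeta s = (\<Sum>m. 1 / real (Suc m) powr s)"

end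

theory Submission
  imports Defs "HOL-Analysis.Analysis"
begin

text \<open>The gap between neighbours with denominators \<open>q\<close>, \<open>q'\<close> is \<open>1 / (q q')\<close>, and the pairs
  \<open>(q, q')\<close> at level \<open>n\<close> arise from \<open>(1, 1)\<close> by words of \<open>n - 1\<close> steps \<open>(x, y) \<mapsto> (x + y, y)\<close> or
  \<open>(x, y) \<mapsto> (x, x + y)\<close>. A word with a maximal block of \<open>a \<ge> n/2\<close> equal steps determines that block.
  If the block comes last, started at \<open>(u, v)\<close> after \<open>s - 1\<close> steps, then \<open>q q' = u\<^sup>2 (n - (s - v/u))\<close>;
  expanding \<open>(q q') powr - \<beta>\<close> in powers of \<open>1/n\<close> and summing over all \<open>(u, v)\<close> gives the terms
  \<open>C\<^sub>k\<close>, with \<open>C\<^sub>0\<close> evaluated by sorting all pairs \<open>v \<le> u\<close> by their greatest common divisor. If the block is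
  followed by further steps, \<open>q q'\<close> is quadratic in \<open>n\<close>, and the same expansion gives the terms
  \<open>C'\<^sub>k\<close>. All coefficients are sums of nonnegative terms. The series and their tails are controlled by
  \<open>s \<le> u\<close> and by bounding the number of \<open>v\<close> by \<open>u\<close>.

  The remaining words either have a block of at least \<open>A = n / (c log n)\<close> steps and at least about \<open>n/2\<close>
  steps outside it, which the same tail estimates cover, or have of order \<open>log n\<close> changes of
  direction. Every change doubles \<open>q q'\<close>, so the latter contribute a negligible amount because
  the gaps \<open>1 / (q q')\<close> sum to 1.\<close>

section \<open>Brocot sequences as words\<close>

text \<open>Words are read from the right: the head of the list is the last step.\<close>

primrec act :: "bool list \<Rightarrow> nat \<times> nat \<Rightarrow> nat \<times> nat" where
  "act [] z = z"
| "act (b # w) z = (if b then (fst (act w z) + snd (act w z), snd (act w z))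
                    else (fst (act w z), fst (act w z) + snd (act w z)))"

definition den :: "bool list \<Rightarrow> nat \<times> nat" where
  "den w = act w (1, 1)"

definition area :: "bool list \<Rightarrow> real" where
  "area w = real (fst (den w)) * real (snd (den w))"

section \<open>Refinement of lists of unimodular neighbours\<close>

fun refine :: "rat list \<Rightarrow> rat list" where
  "refine (x # y # zs) = x # mediant x y # refine (y # zs)"
| "refine zs = zs"

text \<open>For \<open>x = p / q\<close> and \<open>y = p' / q'\<close> in lowest terms this is
  \<open>p' q - p q' = 1\<close>, the relation of Farey neighbours.\<close>

definition unimodular :: "rat \<Rightarrow> rat \<Rightarrow> bool" where
  "unimodular x y \<longleftrightarrow>
     fst (quotient_of y) * snd (quotient_of x) - fst (quotient_of x) * snd (quotient_of y) = 1"

fun chain :: "rat list \<Rightarrow> bool" where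
  "chain (x # y # zs) \<longleftrightarrow> unimodular x y \<and> chain (y # zs)"
| "chain zs \<longleftrightarrow> True"

text \<open>The recursion runs parallel to that of \<open>refine\<close>, so that refining the list
  becomes a change of the summand.\<close>

fun adjacent_sum :: "('a \<Rightarrow> 'a \<Rightarrow> real) \<Rightarrow> 'a list \<Rightarrow> real" where
  "adjacent_sum f (x # y # zs) = f x y + adjacent_sum f (y # zs)"
| "adjacent_sum f zs = 0"

text \<open>A common divisor of \<open>p + p'\<close> and \<open>q + q'\<close> divides
  \<open>(p + p') q - (q + q') p\<close>, which is the determinant 1. So the fraction in
  \<open>mediant\<close> is already reduced, and denominators simply add.\<close>

lemma quotient_of_mediant:
  assumes "unimodular x y"
  shows "quotient_of (mediant x y) =
    (fst (quotient_of x) + fst (quotient_of y), snd (quotient_of x) + snd (quotient_of y))"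
proof -
  obtain p q where x: "quotient_of x = (p, q)" by fastforce
  obtain p' q' where y: "quotient_of y = (p', q')" by fastforce
  have pos: "q > 0" "q' > 0" using quotient_of_denom_pos x y by blast+
  have det: "p' * q - p * q' = 1" using assms by (simp add: unimodular_def x y)
  have "coprime (p + p') (q + q')"
  proof (rule coprimeI)
    fix d assume "d dvd p + p'" "d dvd q + q'"
    hence "d dvd (p + p') * q - (q + q') * p" by (intro dvd_diff dvd_mult2)
    also have "(p + p') * q - (q + q') * p = 1" using det by (simp add: algebra_simps)
    finally show "is_unit d" .
  qed
  thus ?thesis using pos
    by (simp add: mediant_def x y quotient_of_Fract Rat.normalize_def coprime_iff_gcd_eq_1)
qed

lemma unimodular_mediant:
  assumes "unimodular x y"
  shows "unimodular x (mediant x y)" "unimodular (mediant x y) y"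
  using assms quotient_of_mediant[OF assms] by (simp_all add: unimodular_def algebra_simps)

text \<open>Over the common denominator the numerator is the determinant 1.\<close>

lemma unimodular_gap:
  assumes "unimodular x y"
  shows "y - x = 1 / (of_int (snd (quotient_of x)) * of_int (snd (quotient_of y)))"
proof -
  obtain p q where x: "quotient_of x = (p, q)" by fastforce
  obtain p' q' where y: "quotient_of y = (p', q')" by fastforce
  have pos: "q > 0" "q' > 0" using quotient_of_denom_pos x y by blast+
  have det: "of_int p' * of_int q - of_int p * of_int q' = (1 :: rat)"
    using assms unfolding unimodular_def x y by (metis fst_conv snd_conv of_int_1 of_int_diff of_int_mult)
  have "x = of_int p / of_int q" "y = of_int p' / of_int q'"
    using quotient_of_div x y by blast+
  hence "y - x = (of_int p' * of_int q - of_int p * of_int q') / (of_int q * of_int q')"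
    using pos by (simp add: diff_frac_eq mult.commute)
  thus ?thesis using det by (simp add: x y)
qed

lemma unimodular_less: "unimodular x y \<Longrightarrow> x < y"
  using unimodular_gap[of x y] quotient_of_denom_pos'[of x] quotient_of_denom_pos'[of y]
  by (smt (verit) diff_gt_0_iff_gt divide_pos_pos mult_pos_pos of_int_0_less_iff zero_less_one)

lemma chain_refine: "chain xs \<Longrightarrow> chain (refine xs)"
proof (induction xs rule: refine.induct)
  case (1 x y zs)
  then show ?case using unimodular_mediant[of x y]
    by (cases zs) auto
qed auto

lemma chain_sorted: "chain xs \<Longrightarrow> sorted_wrt (<) xs"
proof (induction xs rule: chain.induct)
  case (1 x y zs)
  then show ?case using unimodular_less[of x y] by auto
qed auto

lemma length_refine: "length (refine xs) = 2 * length xs - 1"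
  by (induction xs rule: refine.induct) auto

lemma set_refine:
  "set (refine xs) = set xs \<union> {mediant (xs ! i) (xs ! Suc i) | i. Suc i < length xs}"
proof (induction xs rule: refine.induct)
  case (1 x y zs)
  have "{mediant ((x # y # zs) ! i) ((x # y # zs) ! Suc i) | i. Suc i < length (x # y # zs)}
     = insert (mediant x y) {mediant ((y # zs) ! i) ((y # zs) ! Suc i) | i. Suc i < length (y # zs)}"
    (is "?A = insert _ ?B")
  proof (intro equalityI subsetI)
    fix m assume "m \<in> ?A"
    then obtain i where "m = mediant ((x # y # zs) ! i) ((x # y # zs) ! Suc i)"
      "Suc i < length (x # y # zs)" by blast
    thus "m \<in> insert (mediant x y) ?B" by (cases i) auto
  next
    fix m assume "m \<in> insert (mediant x y) ?B"
    thus "m \<in> ?A"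
    proof
      assume "m = mediant x y"
      thus ?thesis by (intro CollectI exI[of _ 0]) auto
    next
      assume "m \<in> ?B"
      then obtain i where "m = mediant ((y # zs) ! i) ((y # zs) ! Suc i)" "Suc i < length (y # zs)"
        by blast
      thus ?thesis by (intro CollectI exI[of _ "Suc i"]) auto
    qed
  qed
  with 1 show ?case by auto
qed auto

text \<open>The recursion of \<open>brocot\<close> consults its own sorted list, so everything is
  proved in one induction: unimodularity makes the list strictly increasing, hence the sorted
  enumeration, and the length gives the index range. Level \<open>Suc n\<close> is reached after
  \<open>n\<close> refinements.\<close>

lemma sorted_brocot:
  defines "xs \<equiv> \<lambda>n. (refine ^^ n) [0, 1]"
  shows "sorted_list_of_set (brocot (Suc n)) = xs n" "chain (xs n)" "length (xs n) = 2 ^ n + 1"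
proof -
  have *: "chain (xs n) \<and> length (xs n) = 2 ^ n + 1 \<and> set (xs n) = brocot (Suc n)
     \<and> sorted_list_of_set (brocot (Suc n)) = xs n" for n
  proof (induction n)
    case 0
    have "sorted_list_of_set {0, 1 :: rat} = [0, 1]"
      using sorted_list_of_set.idem_if_sorted_distinct[of "[0, 1 :: rat]"] by simp
    then show ?case by (simp add: xs_def unimodular_def)
  next
    case (Suc n)
    have ch: "chain (xs (Suc n))" using Suc by (simp add: xs_def chain_refine)
    have len: "length (xs (Suc n)) = 2 ^ Suc n + 1" using Suc by (simp add: xs_def length_refine)
    have "set (xs (Suc n)) = set (xs n) \<union> {mediant (xs n ! i) (xs n ! Suc i) | i. Suc i < length (xs n)}"
      unfolding xs_def funpow.simps o_def by (rule set_refine)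
    \<comment> \<open>\<open>set_refine\<close> indexes neighbours by the left one,
      \<open>brocot\<close> by the right one.\<close>
    also have "{mediant (xs n ! i) (xs n ! Suc i) | i. Suc i < length (xs n)} =
       {mediant (xs n ! (i - 1)) (xs n ! i) | i. 1 \<le> i \<and> i \<le> 2 ^ n}" (is "?A = ?B")
    proof (intro equalityI subsetI)
      fix m assume "m \<in> ?A"
      then obtain i where "m = mediant (xs n ! i) (xs n ! Suc i)" "Suc i < length (xs n)" by blast
      thus "m \<in> ?B" using Suc by (intro CollectI exI[of _ "Suc i"]) auto
    next
      fix m assume "m \<in> ?B"
      then obtain i where "m = mediant (xs n ! (i - 1)) (xs n ! i)" "1 \<le> i" "i \<le> 2 ^ n" by blast
      thus "m \<in> ?A" using Suc by (intro CollectI exI[of _ "i - 1"]) auto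
    qed
    also have "set (xs n) \<union> ?B = brocot (Suc (Suc n))" using Suc by simp
    finally have st: "set (xs (Suc n)) = brocot (Suc (Suc n))" .
    have "sorted (xs (Suc n)) \<and> distinct (xs (Suc n))"
      using chain_sorted[OF ch] by (simp add: strict_sorted_iff)
    hence "sorted_list_of_set (set (xs (Suc n))) = xs (Suc n)"
      by (simp add: sorted_list_of_set.idem_if_sorted_distinct)
    thus ?case using ch len st by metis
  qed
  from * show "sorted_list_of_set (brocot (Suc n)) = xs n" "chain (xs n)" "length (xs n) = 2 ^ n + 1"
    by blast+
qed

lemma adjacent_sum_refine:
  "adjacent_sum f (refine xs) = adjacent_sum (\<lambda>x y. f x (mediant x y) + f (mediant x y) y) xs"
proof (induction xs rule: refine.induct)
  case (1 x y zs)
  then show ?case by (cases zs) auto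
qed auto

lemma adjacent_sum_cong_chain:
  "chain xs \<Longrightarrow> (\<And>x y. unimodular x y \<Longrightarrow> f x y = g x y) \<Longrightarrow> adjacent_sum f xs = adjacent_sum g xs"
  by (induction xs rule: chain.induct) auto

lemma adjacent_sum_eq_sum:
  "adjacent_sum f xs = (\<Sum>i = 1..<length xs. f (xs ! (i - 1)) (xs ! i))"
proof (induction f xs rule: adjacent_sum.induct)
  case (1 f x y zs)
  have "(\<Sum>i = 1..<length (x # y # zs). f ((x # y # zs) ! (i - 1)) ((x # y # zs) ! i))
     = f x y + (\<Sum>i = Suc 1..<Suc (length (y # zs)). f ((x # y # zs) ! (i - 1)) ((x # y # zs) ! i))"
    by (subst sum.atLeast_Suc_lessThan) auto
  also have "(\<Sum>i = Suc 1..<Suc (length (y # zs)). f ((x # y # zs) ! (i - 1)) ((x # y # zs) ! i))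
     = (\<Sum>i = 1..<length (y # zs). f ((y # zs) ! (i - 1)) ((y # zs) ! i))"
    by (subst sum.shift_bounds_Suc_ivl) (auto intro!: sum.cong simp: nth_Cons')
  finally show ?case using 1 by simp
qed auto

section \<open>Sums over a level as sums over words\<close>

lemma finite_words [simp]: "finite {w :: bool list. length w = n}"
  using finite_lists_length_eq[of "UNIV :: bool set" n] by simp

lemma sum_words_Suc:
  fixes f :: "bool list \<Rightarrow> real"
  shows "(\<Sum>w | length w = Suc n. f w) = (\<Sum>w | length w = n. f (False # w) + f (True # w))"
proof -
  have eq: "{w :: bool list. length w = Suc n} =
      (#) False ` {w. length w = n} \<union> (#) True ` {w. length w = n}"
    by (auto simp: length_Suc_conv image_iff)
  show ?thesis unfolding eq sum.distrib
    by (subst sum.union_disjoint) (auto simp: sum.reindex)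
qed

text \<open>Refining once more and prepending a letter both replace \<open>g x y\<close> by
  \<open>g x (x + y) + g (x + y) y\<close>; the induction therefore needs \<open>g\<close>
  arbitrary.\<close>

lemma adjacent_sum_den:
  fixes g :: "nat \<Rightarrow> nat \<Rightarrow> real"
  defines "q \<equiv> \<lambda>x. nat (snd (quotient_of x))"
  shows "adjacent_sum (\<lambda>x y. g (q x) (q y)) ((refine ^^ n) [0, 1]) =
    (\<Sum>w | length w = n. g (fst (den w)) (snd (den w)))"
proof (induction n arbitrary: g)
  case 0
  then show ?case by (simp add: q_def den_def)
next
  case (Suc n)
  have "adjacent_sum (\<lambda>x y. g (q x) (q y)) ((refine ^^ Suc n) [0, 1]) =
    adjacent_sum (\<lambda>x y. g (q x) (q (mediant x y)) + g (q (mediant x y)) (q y)) ((refine ^^ n) [0, 1])"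
    by (simp add: adjacent_sum_refine)
  also have "\<dots> = adjacent_sum (\<lambda>x y. g (q x) (q x + q y) + g (q x + q y) (q y)) ((refine ^^ n) [0, 1])"
  proof (rule adjacent_sum_cong_chain[OF sorted_brocot(2)])
    fix x y assume "unimodular x y"
    hence "q (mediant x y) = q x + q y"
      using quotient_of_denom_pos'[of x] quotient_of_denom_pos'[of y]
      by (simp add: q_def quotient_of_mediant nat_add_distrib)
    thus "g (q x) (q (mediant x y)) + g (q (mediant x y)) (q y)
      = g (q x) (q x + q y) + g (q x + q y) (q y)" by simp
  qed
  also have "\<dots> = (\<Sum>w | length w = n. g (fst (den w)) (fst (den w) + snd (den w))
       + g (fst (den w) + snd (den w)) (snd (den w)))"
    by (rule Suc.IH[of "\<lambda>x y. g x (x + y) + g (x + y) y"])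
  also have "\<dots> = (\<Sum>w | length w = Suc n. g (fst (den w)) (snd (den w)))"
    by (simp add: sum_words_Suc den_def)
  finally show ?case .
qed

lemma brocot_sigma_eq_sum_words:
  "brocot_sigma \<beta> (Suc n) = (\<Sum>w | length w = n. area w powr - \<beta>)"
proof -
  define xs where "xs = (refine ^^ n) [0, 1]"
  have "brocot_sigma \<beta> (Suc n) = (\<Sum>i = 1..2 ^ n. of_rat (xs ! i - xs ! (i - 1)) powr \<beta>)"
    by (simp add: brocot_sigma_def brocot_gap_def brocot_elem_def sorted_brocot(1) of_rat_diff xs_def)
  also have "\<dots> = adjacent_sum (\<lambda>x y. of_rat (y - x) powr \<beta>) xs"
    unfolding adjacent_sum_eq_sum by (rule sum.cong) (auto simp: sorted_brocot(3) xs_def)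
  also have "\<dots> = adjacent_sum (\<lambda>x y. (real (nat (snd (quotient_of x))) * real (nat (snd (quotient_of y)))) powr - \<beta>) xs"
  proof (rule adjacent_sum_cong_chain)
    show "chain xs" unfolding xs_def by (rule sorted_brocot)
    fix x y assume "unimodular x y"
    from unimodular_gap[OF this]
    show "real_of_rat (y - x) powr \<beta> = (real (nat (snd (quotient_of x))) * real (nat (snd (quotient_of y)))) powr - \<beta>"
      using quotient_of_denom_pos'[of x] quotient_of_denom_pos'[of y]
      by (simp add: of_rat_divide of_rat_mult powr_minus_divide powr_divide)
  qed
  also have "\<dots> = (\<Sum>w | length w = n. area w powr - \<beta>)"
    unfolding xs_def area_def by (rule adjacent_sum_den[of "\<lambda>x y. (real x * real y) powr - \<beta>"])
  finally show ?thesis .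
qed

section \<open>Denominators and blocks\<close>

text \<open>\<open>w\<close> acts first, since words are read from the right.\<close>

lemma act_append: "act (r @ w) z = act r (act w z)"
  by (induction r) auto

lemma act_linear:
  "act w (x, y) = (x * fst (act w (1, 0)) + y * fst (act w (0, 1)),
                   x * snd (act w (1, 0)) + y * snd (act w (0, 1)))"
  by (induction w) (auto simp: algebra_simps)

lemma act_swap: "act (map Not w) (y, x) = prod.swap (act w (x, y))"
  by (induction w) auto

lemma den_simps [simp]:
  "den [] = (1, 1)"
  "den (True # w) = (fst (den w) + snd (den w), snd (den w))"
  "den (False # w) = (fst (den w), fst (den w) + snd (den w))"
  by (simp_all add: den_def)

lemma den_pos: "fst (den w) > 0" "snd (den w) > 0"
proof -
  have "fst (den w) > 0 \<and> snd (den w) > 0"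
  proof (induction w)
    case (Cons b w)
    then show ?case by (cases b) auto
  qed simp
  thus "fst (den w) > 0" "snd (den w) > 0" by auto
qed

lemma area_pos: "area w > 0"
  using den_pos[of w] by (simp add: area_def)

lemma area_ge_1: "area w \<ge> 1"
proof -
  have "fst (den w) * snd (den w) \<ge> 1" using den_pos[of w] by (simp add: Suc_leI)
  thus ?thesis unfolding area_def by (metis of_nat_1 of_nat_le_iff of_nat_mult)
qed

text \<open>Exchanging the letters swaps the coordinates and fixes the start \<open>(1, 1)\<close>.
  Hence only blocks of \<open>False\<close> need a computation, and a factor 2 accounts for the
  others.\<close>

lemma area_map_Not: "area (map Not w) = area w"
  using act_swap[of w 1 1] by (simp add: area_def den_def)

lemma coprime_den: "coprime (fst (den w)) (snd (den w))"
proof (induction w)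
  case (Cons b w)
  then show ?case by (cases b) (auto simp: coprime_iff_gcd_eq_1)
qed simp

text \<open>The larger coordinate reveals the last step, and subtracting the smaller one from it
  undoes that step.\<close>

lemma inj_den: "inj den"
proof (rule injI)
  fix v w show "den v = den w \<Longrightarrow> v = w"
  proof (induction v arbitrary: w)
    case Nil
    show ?case
    proof (cases w)
      case (Cons b w')
      thus ?thesis using Nil den_pos[of w'] by (cases b) auto
    qed simp
  next
    case (Cons b v)
    show ?case
    proof (cases w)
      case Nil
      thus ?thesis using Cons.prems den_pos[of v] by (cases b) auto
    next
      case (Cons c w')
      have "b = c" using Cons.prems den_pos[of v] den_pos[of w'] Cons
        by (cases b; cases c) auto
      moreover have "den v = den w'"
        using Cons.prems Cons \<open>b = c\<close> by (cases b) (auto simp: prod_eq_iff)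
      ultimately show ?thesis using Cons.IH Cons by simp
    qed
  qed
qed

text \<open>This is the subtractive Euclidean algorithm; when both coordinates agree, coprimality
  forces \<open>(1, 1)\<close>.\<close>

lemma den_surj:
  assumes "coprime x y" "x > 0" "y > 0"
  shows "\<exists>w. den w = (x, y)"
  using assms
proof (induction "x + y" arbitrary: x y rule: less_induct)
  case less
  consider "x = y" | "x < y" | "y < x" by linarith
  thus ?case
  proof cases
    case 1
    hence "den [] = (x, y)" using less.prems by simp
    thus ?thesis by blast
  next
    case 2
    have "coprime x (y - x)" using less.prems(1) gcd_diff1_nat[of x y] 2
      by (simp add: coprime_iff_gcd_eq_1 gcd.commute)
    then obtain w where "den w = (x, y - x)" using less.hyps[of x "y - x"] less.prems 2 by auto
    hence "den (False # w) = (x, y)" using 2 by simp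
    thus ?thesis by blast
  next
    case 3
    have "coprime (x - y) y" using less.prems 3
      by (simp add: coprime_iff_gcd_eq_1 gcd_diff1_nat)
    then obtain w where "den w = (x - y, y)" using less.hyps[of "x - y" y] less.prems 3 by auto
    hence "den (True # w) = (x, y)" using 3 by simp
    thus ?thesis by blast
  qed
qed

text \<open>Each step creates the sum of two positive coordinates, which exceeds the old
  maximum.\<close>

lemma length_less_max_den: "length w < max (fst (den w)) (snd (den w))"
proof (induction w)
  case (Cons b w)
  then show ?case using den_pos[of w] by (cases b) auto
qed simp

lemma length_less_area: "real (Suc (length w)) \<le> area w"
proof -
  have "max (fst (den w)) (snd (den w)) \<le> fst (den w) * snd (den w)"
    using den_pos[of w] by (simp add: max_def)
  hence "Suc (length w) \<le> fst (den w) * snd (den w)"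
    using length_less_max_den[of w] by linarith
  thus ?thesis unfolding area_def by (metis of_nat_le_iff of_nat_mult)
qed

text \<open>A mediant splits a gap without changing the total length:
  \<open>1 / (x (x + y)) + 1 / ((x + y) y) = 1 / (x y)\<close>.\<close>

lemma sum_inverse_area: "(\<Sum>w | length w = n. 1 / area w) = 1"
proof (induction n)
  case (Suc n)
  have "1 / area (False # w) + 1 / area (True # w) = 1 / area w" for w
    using den_pos[of w] by (simp add: area_def divide_simps)
  thus ?case using Suc by (simp add: sum_words_Suc)
qed (simp add: area_def)

text \<open>What can precede a maximal block of \<open>False\<close>.\<close>

definition heads :: "bool list set" where
  "heads = {p. p = [] \<or> hd p}"

lemma heads_den_le: "p \<in> heads \<Longrightarrow> snd (den p) \<le> fst (den p)"
  by (cases p) (auto simp: heads_def)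

lemma heads_length_less: "p \<in> heads \<Longrightarrow> length p < fst (den p)"
  using heads_den_le[of p] length_less_max_den[of p] by (simp add: max_absorb1)

text \<open>The last step decides which coordinate is larger. The description by coprime pairs
  serves to evaluate the leading coefficient.\<close>

lemma den_image_heads: "den ` heads = {(u, v). coprime u v \<and> 1 \<le> v \<and> v \<le> u}"
proof (intro equalityI subsetI)
  fix z assume "z \<in> den ` heads"
  thus "z \<in> {(u, v). coprime u v \<and> 1 \<le> v \<and> v \<le> u}"
    using coprime_den heads_den_le den_pos by (auto simp: Suc_le_eq case_prod_unfold)
next
  fix z assume "z \<in> {(u, v). coprime u v \<and> 1 \<le> v \<and> v \<le> (u :: nat)}"
  then obtain u v where z: "z = (u, v)" "coprime u v" "1 \<le> v" "v \<le> u" by auto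
  then obtain w where w: "den w = (u, v)" using den_surj[of u v] by auto
  have "w \<in> heads"
  proof (cases w)
    case (Cons b w')
    thus ?thesis using w z(4) den_pos[of w'] by (cases b) (auto simp: heads_def)
  qed (simp add: heads_def)
  thus "z \<in> den ` heads" using w z by force
qed

lemma den_replicate_append:
  "den (replicate a False @ p) = (fst (den p), snd (den p) + a * fst (den p))"
  by (induction a) auto

lemma area_block_last:
  "area (replicate a False @ p) = real (fst (den p)) * (real (snd (den p)) + real a * real (fst (den p)))"
  by (simp add: area_def den_replicate_append)

lemma act_one_zero_le: "fst (act w (1, 0)) \<le> fst (den w)" "snd (act w (1, 0)) \<le> snd (den w)"
  using act_linear[of w 1 1] by (simp_all add: den_def)

text \<open>After \<open>p\<close>, the block and \<open>True\<close> the pair is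
  \<open>(Y + u, Y)\<close> with \<open>Y = v + a u\<close>. Writing it as
  \<open>Y (1, 1) + u (1, 0)\<close> and using linearity of \<open>act r\<close> gives the two
  factors, each linear in \<open>a\<close>.\<close>

lemma area_block_inner:
  fixes a r p
  defines "u \<equiv> real (fst (den p))" and "v \<equiv> real (snd (den p))"
  shows "area (r @ True # replicate a False @ p) =
    (real (fst (den r)) * (v + a * u) + real (fst (act r (1, 0))) * u) *
    (real (snd (den r)) * (v + a * u) + real (snd (act r (1, 0))) * u)"
proof -
  have "den (r @ True # replicate a False @ p) = act r (act (True # replicate a False) (den p))"
    using act_append[of "r @ True # replicate a False" p "(1, 1)"]
      act_append[of r "True # replicate a False"] by (simp add: den_def)
  also have "act (True # replicate a False) (den p) = den (True # replicate a False @ p)"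
    using act_append[of "True # replicate a False" p "(1, 1)"] by (simp add: den_def)
  also have "\<dots> = (fst (den p) + (snd (den p) + a * fst (den p)), snd (den p) + a * fst (den p))"
    by (simp add: den_replicate_append)
  finally have *: "den (r @ True # replicate a False @ p) =
    act r (fst (den p) + (snd (den p) + a * fst (den p)), snd (den p) + a * fst (den p))" .
  show ?thesis
    unfolding area_def * u_def v_def using act_linear[of r 1 1]
      act_linear[of r "fst (den p) + (snd (den p) + a * fst (den p))" "snd (den p) + a * fst (den p)"]
    by (simp add: den_def algebra_simps)
qed

text \<open>Two blocks covering more than half of a word overlap, hence coincide if they are maximal.\<close>

lemma long_block_unique:
  fixes r p r' p' :: "'a list"
  assumes eq: "r @ replicate a b @ p = r' @ replicate a' b' @ p'"
    and p: "p = [] \<or> hd p \<noteq> b" and p': "p' = [] \<or> hd p' \<noteq> b'"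
    and r: "r = [] \<or> last r \<noteq> b" and r': "r' = [] \<or> last r' \<noteq> b'"
    and long: "length r + length p < a" "length r' + length p' < a'"
  shows "r = r' \<and> b = b' \<and> p = p' \<and> a = a'"
proof -
  have main: "length r' \<le> length r \<and> b = b'"
    if eq: "r @ replicate a b @ p = r' @ replicate a' b' @ p'"
      and r': "r' = [] \<or> last r' \<noteq> b'"
      and long: "length r + length p < a" "length r' + length p' < a'" and le: "length r \<le> length r'"
    for r r' p p' :: "'a list" and a a' b b'
  proof -
    define w where "w = r @ replicate a b @ p"
    have len: "length r + a + length p = length r' + a' + length p'"
      using arg_cong[OF eq, of length] by simp
    have wb: "w ! i = b" if "length r \<le> i" "i < length r + a" for i
    proof -
      have "i - length r < a" using that by linarith
      thus ?thesis using that by (simp add: w_def nth_append)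
    qed
    have wb': "w ! i = b'" if "length r' \<le> i" "i < length r' + a'" for i
    proof -
      have "i - length r' < a'" using that by linarith
      thus ?thesis using that unfolding w_def eq by (simp add: nth_append)
    qed
    have in_block: "length r' < length r + a" using len long by linarith
    have "b = b'" using wb[of "length r'"] wb'[of "length r'"] in_block le long by simp
    moreover have "\<not> length r < length r'"
    proof
      assume *: "length r < length r'"
      hence ne: "r' \<noteq> []" by auto
      have "w ! (length r' - 1) = last r'"
        using ne unfolding w_def eq by (simp add: nth_append last_conv_nth)
      moreover have "w ! (length r' - 1) = b" using * in_block by (intro wb) auto
      ultimately show False using r' ne \<open>b = b'\<close> by simp
    qed
    ultimately show ?thesis by simp
  qed
  have *: "length r = length r' \<and> b = b'"
    using main[OF eq r' long] main[OF eq[symmetric] r long(2,1)] by force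
  hence req: "r = r'" and beq: "b = b'" and eq2: "replicate a b @ p = replicate a' b' @ p'"
    using eq by auto
  have "a = length (takeWhile (\<lambda>x. x = b) (replicate a b @ p))" if "p = [] \<or> hd p \<noteq> b" for a p
    using that by (induction a) (cases p, auto)
  from this[OF p, of a] this[of p' a'] have "a = a'" using p' beq eq2 by simp
  thus ?thesis using req beq eq2 by simp
qed

section \<open>Changes of direction\<close>

fun changes :: "bool list \<Rightarrow> nat" where
  "changes (x # y # zs) = (if x = y then 0 else 1) + changes (y # zs)"
| "changes zs = 0"

text \<open>At a change of letter the step replaces the smaller coordinate by the sum, which is at
  least twice as large; other steps do not decrease the product.\<close>

lemma area_ge_changes: "area w \<ge> 2 ^ changes w"
proof (induction w rule: changes.induct)
  case (1 x y zs)
  have pos: "fst (den zs) > 0" "snd (den zs) > 0" by (rule den_pos)+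
  have "area (x # y # zs) \<ge> (if x = y then 1 else 2) * area (y # zs)"
    using pos by (cases x; cases y) (auto simp: area_def algebra_simps)
  moreover have "(if x = y then 1 else 2) * area (y # zs) \<ge> (if x = y then 1 else 2) * 2 ^ changes (y # zs)"
    using 1 by auto
  ultimately show ?case by (auto split: if_splits)
qed (use area_ge_1 in auto)

lemma changes_replicate_append:
  assumes "p \<noteq> []" "hd p \<noteq> b" "a > 0"
  shows "changes (replicate a b @ p) = Suc (changes p)"
  using assms(3)
proof (induction a)
  case (Suc a)
  show ?case
  proof (cases a)
    case 0
    thus ?thesis using assms by (cases p) auto
  next
    case (Suc a')
    thus ?thesis using Suc.IH by simp
  qed
qed simp

text \<open>A nonempty word has one more maximal block than it has changes, so if all blocks are
  shorter than \<open>A\<close>, the length is at most \<open>A\<close> times that number. The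
  induction strips the leading block.\<close>

lemma long_block_or_many_changes:
  assumes "A > (0 :: real)"
  shows "(\<exists>r a b p. w = r @ replicate a b @ p \<and> (p = [] \<or> hd p \<noteq> b) \<and> (r = [] \<or> last r \<noteq> b) \<and> A \<le> real a)
     \<or> real (length w) \<le> A * (real (changes w) + 1)"
proof (induction w rule: length_induct)
  case (1 w)
  show ?case
  proof (cases w)
    case Nil
    thus ?thesis using assms by simp
  next
    case (Cons b w')
    define a where "a = length (takeWhile (\<lambda>x. x = b) w)"
    define p where "p = dropWhile (\<lambda>x. x = b) w"
    have "takeWhile (\<lambda>x. x = b) w = replicate a b"
      unfolding a_def by (rule replicate_eqI[symmetric, THEN sym]) (auto dest: set_takeWhileD)
    hence w: "w = replicate a b @ p" using takeWhile_dropWhile_id[of "\<lambda>x. x = b" w] by (simp add: p_def)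
    have hd: "p = [] \<or> hd p \<noteq> b" unfolding p_def using hd_dropWhile by blast
    have a: "a > 0" by (simp add: a_def Cons)
    show ?thesis
    proof (cases "A \<le> real a")
      case True
      thus ?thesis using w hd by (intro disjI1 exI[of _ "[]"] exI[of _ a] exI[of _ b] exI[of _ p]) auto
    next
      case small: False
      show ?thesis
      proof (cases "p = []")
        case True
        hence "real (length w) \<le> A * 1" using w small by simp
        also have "\<dots> \<le> A * (real (changes w) + 1)" using assms by (intro mult_left_mono) auto
        finally show ?thesis by blast
      next
        case False
        have "length p < length w" using w a by simp
        with "1.IH" consider
          (block) r' a' b' p' where "p = r' @ replicate a' b' @ p'" "p' = [] \<or> hd p' \<noteq> b'"
            "r' = [] \<or> last r' \<noteq> b'" "A \<le> real a'"
          | (many) "real (length p) \<le> A * (real (changes p) + 1)" by blast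
        thus ?thesis
        proof cases
          case block
          have a': "a' > 0" using block(4) assms by (cases a') auto
          \<comment> \<open>The block found in \<open>p\<close> must stay maximal when the stripped
            block is put back; for \<open>r' = []\<close> this holds because \<open>p\<close> starts
            with a letter other than \<open>b\<close>.\<close>
          have "last (replicate a b @ r') \<noteq> b'"
          proof (cases "r' = []")
            case True
            hence "hd p = b'" using block(1) a' by (cases a') auto
            thus ?thesis using True hd False a by auto
          next
            case False
            thus ?thesis using block(3) by simp
          qed
          thus ?thesis using block w by (intro disjI1 exI[of _ "replicate a b @ r'"] exI[of _ a'] exI[of _ b'] exI[of _ p']) auto
        next
          case many
          have "changes w = Suc (changes p)"
            using hd False a unfolding w by (intro changes_replicate_append) auto
          thus ?thesis using many small w by (simp add: algebra_simps)
        qed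
      qed
    qed
  qed
qed

section \<open>Taylor expansion\<close>

text \<open>The coefficients of the binomial series of \<open>(1 - x) powr - \<beta>\<close>. They
  are positive for \<open>\<beta> > 0\<close>, which is the source of the positivity of the final
  coefficients.\<close>

definition negbin :: "real \<Rightarrow> nat \<Rightarrow> real" where
  "negbin \<beta> k = pochhammer \<beta> k / fact k"

text \<open>The homogeneous part of degree \<open>k\<close> of the Taylor series of
  \<open>(1 - x) powr - \<beta> * (1 - y) powr - \<beta>\<close>.\<close>

definition hom_part :: "real \<Rightarrow> nat \<Rightarrow> real \<Rightarrow> real \<Rightarrow> real" where
  "hom_part \<beta> k x y = (\<Sum>i\<le>k. (negbin \<beta> i * x ^ i) * (negbin \<beta> (k - i) * y ^ (k - i)))"

lemma negbin_0 [simp]: "negbin \<beta> 0 = 1"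
  by (simp add: negbin_def)

lemma negbin_pos: "\<beta> > 0 \<Longrightarrow> negbin \<beta> k > 0"
  by (simp add: negbin_def pochhammer_pos)

lemma negbin_sums:
  assumes "\<bar>x\<bar> < 1"
  shows "(\<lambda>k. negbin \<beta> k * x ^ k) sums (1 - x) powr - \<beta>"
proof -
  have "(- \<beta> gchoose k) * (- x) ^ k = negbin \<beta> k * x ^ k" for k
  proof -
    have "(- \<beta> gchoose k) * (- x) ^ k = ((- 1) ^ k * (- 1) ^ k) * (negbin \<beta> k * x ^ k)"
      by (simp add: gbinomial_pochhammer negbin_def power_minus[of x])
    also have "(- 1) ^ k * (- 1) ^ k = (1 :: real)" by (simp flip: power_add)
    finally show ?thesis by simp
  qed
  thus ?thesis using gen_binomial_real[of "- x" "- \<beta>"] assms by simp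
qed

lemma hom_part_0 [simp]: "hom_part \<beta> 0 x y = 1"
  by (simp add: hom_part_def)

lemma hom_part_zero_right: "hom_part \<beta> k x 0 = negbin \<beta> k * x ^ k"
proof -
  have "hom_part \<beta> k x 0 = (\<Sum>i\<in>{k}. (negbin \<beta> i * x ^ i) * (negbin \<beta> (k - i) * 0 ^ (k - i)))"
    unfolding hom_part_def by (rule sum.mono_neutral_right) auto
  thus ?thesis by simp
qed

lemma hom_part_scale: "hom_part \<beta> k (c * x) (c * y) = c ^ k * hom_part \<beta> k x y"
  unfolding hom_part_def sum_distrib_left
proof (rule sum.cong)
  fix i assume "i \<in> {..k}"
  hence "c ^ k = c ^ i * c ^ (k - i)" by (simp flip: power_add)
  thus "negbin \<beta> i * (c * x) ^ i * (negbin \<beta> (k - i) * (c * y) ^ (k - i)) =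
    c ^ k * (negbin \<beta> i * x ^ i * (negbin \<beta> (k - i) * y ^ (k - i)))"
    by (simp add: power_mult_distrib)
qed simp

lemma hom_part_divide: "hom_part \<beta> k (x / c) (y / c) = hom_part \<beta> k x y / c ^ k"
  using hom_part_scale[of \<beta> k "1 / c" x y] by (simp add: power_divide)

lemma hom_part_nonneg: "\<beta> > 0 \<Longrightarrow> 0 \<le> x \<Longrightarrow> 0 \<le> y \<Longrightarrow> 0 \<le> hom_part \<beta> k x y"
  unfolding hom_part_def by (intro sum_nonneg mult_nonneg_nonneg less_imp_le[OF negbin_pos]) auto

lemma hom_part_pos: "\<beta> > 0 \<Longrightarrow> 0 < x \<Longrightarrow> 0 < y \<Longrightarrow> 0 < hom_part \<beta> k x y"
  unfolding hom_part_def by (intro sum_pos mult_pos_pos negbin_pos) auto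

lemma hom_part_mono:
  assumes "\<beta> > 0" "0 \<le> x" "0 \<le> y" "x \<le> x'" "y \<le> y'"
  shows "hom_part \<beta> k x y \<le> hom_part \<beta> k x' y'"
  unfolding hom_part_def using assms
  by (intro sum_mono mult_mono mult_left_mono power_mono mult_nonneg_nonneg less_imp_le[OF negbin_pos]) auto

lemma hom_part_sums:
  assumes "\<bar>x\<bar> < 1" "\<bar>y\<bar> < 1" "\<beta> > 0"
  shows "(\<lambda>k. hom_part \<beta> k x y) sums ((1 - x) powr - \<beta> * (1 - y) powr - \<beta>)"
proof -
  have abs: "summable (\<lambda>k. norm (negbin \<beta> k * t ^ k))" if "\<bar>t\<bar> < 1" for t
    using sums_summable[OF negbin_sums[of "\<bar>t\<bar>" \<beta>]] that negbin_pos[OF assms(3)]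
    by (simp add: abs_mult power_abs abs_of_pos)
  have "(\<lambda>k. \<Sum>i\<le>k. (negbin \<beta> i * x ^ i) * (negbin \<beta> (k - i) * y ^ (k - i))) sums
     ((\<Sum>k. negbin \<beta> k * x ^ k) * (\<Sum>k. negbin \<beta> k * y ^ k))"
    by (rule Cauchy_product_sums) (use abs assms in auto)
  thus ?thesis unfolding hom_part_def
    using sums_unique[OF negbin_sums[OF assms(1), of \<beta>]] sums_unique[OF negbin_sums[OF assms(2), of \<beta>]]
    by simp
qed

lemma hom_part_half_sums:
  assumes "\<beta> > 0"
  shows "(\<lambda>k. hom_part \<beta> k (1/2) (1/2)) sums (4 powr \<beta>)"
proof -
  have "(1/2) powr - \<beta> * (1/2) powr - \<beta> = (4 :: real) powr \<beta>"
    by (simp add: powr_minus_divide powr_divide flip: powr_mult)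
  thus ?thesis using hom_part_sums[of "1/2" "1/2" \<beta>] assms by simp
qed

text \<open>Monotonicity and homogeneity reduce the bound to the point \<open>(1/2, 1/2)\<close>,
  where the whole series has the finite sum \<open>4 powr \<beta>\<close>.\<close>

lemma hom_part_le_scaled:
  assumes "\<beta> > 0" "0 \<le> x" "0 \<le> y" "x \<le> z" "y \<le> z"
  shows "hom_part \<beta> k x y \<le> (2 * z) ^ k * hom_part \<beta> k (1/2) (1/2)"
  using hom_part_mono[OF assms, of k] hom_part_scale[of \<beta> k "2 * z" "1/2" "1/2"] by simp

lemma hom_part_half_nonneg: "\<beta> > 0 \<Longrightarrow> hom_part \<beta> k (1/2) (1/2) \<ge> 0"
  by (rule hom_part_nonneg) auto

lemma sum_hom_part_half_le:
  assumes "\<beta> > 0" "finite A"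
  shows "(\<Sum>k\<in>A. hom_part \<beta> k (1/2) (1/2)) \<le> 4 powr \<beta>"
  using sum_le_suminf[OF sums_summable[OF hom_part_half_sums[OF assms(1)]] assms(2)]
    sums_unique[OF hom_part_half_sums[OF assms(1)]] hom_part_half_nonneg[OF assms(1)] by simp

lemma hom_part_le:
  assumes "\<beta> > 0" "0 \<le> x" "0 \<le> y" "x \<le> z" "y \<le> z"
  shows "hom_part \<beta> k x y \<le> 4 powr \<beta> * (2 * z) ^ k"
proof -
  have "hom_part \<beta> k (1/2) (1/2) \<le> 4 powr \<beta>" using sum_hom_part_half_le[OF assms(1), of "{k}"] by simp
  hence "(2 * z) ^ k * hom_part \<beta> k (1/2) (1/2) \<le> (2 * z) ^ k * 4 powr \<beta>"
    using assms by (intro mult_left_mono) auto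
  thus ?thesis using hom_part_le_scaled[OF assms, of k] by (simp add: mult.commute)
qed

text \<open>For \<open>z \<ge> 1/2\<close> the powers of \<open>2 z\<close> increase, so the highest
  one dominates. This is meant for indices outside the finite sum, where only the Taylor polynomial
  is present.\<close>

lemma sum_hom_part_le_large:
  assumes "\<beta> > 0" "0 \<le> x" "0 \<le> y" "x \<le> z" "y \<le> z" "1/2 \<le> z" "K \<le> Suc m"
  shows "(\<Sum>k<K. hom_part \<beta> k x y) \<le> 4 powr \<beta> * (2 * z) ^ m"
proof -
  have "(\<Sum>k<K. hom_part \<beta> k x y) \<le> (\<Sum>k<K. (2 * z) ^ m * hom_part \<beta> k (1/2) (1/2))"
  proof (rule sum_mono)
    fix k assume "k \<in> {..<K}"
    hence "(2 * z) ^ k \<le> (2 * z) ^ m" using assms by (intro power_increasing) auto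
    hence "(2 * z) ^ k * hom_part \<beta> k (1/2) (1/2) \<le> (2 * z) ^ m * hom_part \<beta> k (1/2) (1/2)"
      using hom_part_half_nonneg[OF assms(1)] by (intro mult_right_mono) auto
    thus "hom_part \<beta> k x y \<le> (2 * z) ^ m * hom_part \<beta> k (1/2) (1/2)"
      using hom_part_le_scaled[OF assms(1-5), of k] by linarith
  qed
  also have "\<dots> = (2 * z) ^ m * (\<Sum>k<K. hom_part \<beta> k (1/2) (1/2))" by (simp add: sum_distrib_left)
  also have "\<dots> \<le> (2 * z) ^ m * 4 powr \<beta>"
    using assms sum_hom_part_half_le[OF assms(1)] by (intro mult_left_mono) auto
  finally show ?thesis by (simp add: mult.commute)
qed

text \<open>For \<open>z \<le> 1/2\<close> the powers of \<open>2 z\<close> decrease, so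
  \<open>(2 z) ^ K\<close> comes out of the tail and leaves a tail of the series at
  \<open>(1/2, 1/2)\<close>.\<close>

lemma hom_part_remainder:
  assumes "\<beta> > 0" "0 \<le> x" "0 \<le> y" "x \<le> z" "y \<le> z" "z \<le> 1/2"
  shows "\<bar>(1 - x) powr - \<beta> * (1 - y) powr - \<beta> - (\<Sum>k<K. hom_part \<beta> k x y)\<bar> \<le> 4 powr \<beta> * (2 * z) ^ K"
proof -
  have s: "(\<lambda>k. hom_part \<beta> k x y) sums ((1 - x) powr - \<beta> * (1 - y) powr - \<beta>)"
    by (rule hom_part_sums) (use assms in auto)
  have tail: "(\<lambda>k. hom_part \<beta> (k + K) x y) sums
      ((1 - x) powr - \<beta> * (1 - y) powr - \<beta> - (\<Sum>k<K. hom_part \<beta> k x y))"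
    using s by (subst sums_iff_shift) simp
  have half: "(\<lambda>k. hom_part \<beta> (k + K) (1/2) (1/2)) sums
      (4 powr \<beta> - (\<Sum>k<K. hom_part \<beta> k (1/2) (1/2)))"
    using hom_part_half_sums[OF assms(1)] by (subst sums_iff_shift) simp
  have "0 \<le> (1 - x) powr - \<beta> * (1 - y) powr - \<beta> - (\<Sum>k<K. hom_part \<beta> k x y)"
    using assms by (intro sums_le[OF _ sums_zero tail] hom_part_nonneg) auto
  moreover have "(1 - x) powr - \<beta> * (1 - y) powr - \<beta> - (\<Sum>k<K. hom_part \<beta> k x y)
      \<le> (2 * z) ^ K * (4 powr \<beta> - (\<Sum>k<K. hom_part \<beta> k (1/2) (1/2)))"
  proof (rule sums_le[OF _ tail sums_mult[OF half]])
    fix k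
    have "(2 * z) ^ (k + K) \<le> (2 * z) ^ K" using assms by (intro power_decreasing) auto
    hence "(2 * z) ^ (k + K) * hom_part \<beta> (k + K) (1/2) (1/2) \<le> (2 * z) ^ K * hom_part \<beta> (k + K) (1/2) (1/2)"
      using hom_part_half_nonneg[OF assms(1)] by (intro mult_right_mono) auto
    thus "hom_part \<beta> (k + K) x y \<le> (2 * z) ^ K * hom_part \<beta> (k + K) (1/2) (1/2)"
      using hom_part_le_scaled[OF assms(1-5), of "k + K"] by linarith
  qed
  moreover have "(2 * z) ^ K * (4 powr \<beta> - (\<Sum>k<K. hom_part \<beta> k (1/2) (1/2))) \<le> (2 * z) ^ K * 4 powr \<beta>"
    using assms by (intro mult_left_mono) (auto intro!: sum_nonneg hom_part_nonneg)
  ultimately show ?thesis by (simp add: mult.commute)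
qed

section \<open>Summability over words\<close>

lemma summable_on_bounded:
  fixes f :: "'a \<Rightarrow> real"
  assumes "\<And>x. x \<in> A \<Longrightarrow> 0 \<le> f x" "\<And>F. finite F \<Longrightarrow> F \<subseteq> A \<Longrightarrow> sum f F \<le> B"
  shows "f summable_on A" "infsum f A \<le> B"
proof -
  show "f summable_on A"
    using assms by (intro nonneg_bdd_above_summable_on bdd_aboveI2[of _ _ B]) auto
  thus "infsum f A \<le> B" using assms(2) by (rule infsum_le_finite_sums)
qed

lemma summable_on_times:
  fixes f :: "'a \<Rightarrow> real" and g :: "'b \<Rightarrow> real"
  assumes f: "f summable_on A" "\<And>x. x \<in> A \<Longrightarrow> 0 \<le> f x"
    and g: "g summable_on B" "\<And>y. y \<in> B \<Longrightarrow> 0 \<le> g y"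
  shows "(\<lambda>(x, y). f x * g y) summable_on A \<times> B"
proof (rule summable_on_bounded)
  fix F assume F: "finite F" "F \<subseteq> A \<times> B"
  have "(\<Sum>(x, y)\<in>F. f x * g y) \<le> (\<Sum>(x, y)\<in>fst ` F \<times> snd ` F. f x * g y)"
    using F f g by (intro sum_mono2) (force simp: subset_iff)+
  also have "\<dots> = sum f (fst ` F) * sum g (snd ` F)"
    by (simp add: sum_product sum.cartesian_product)
  also have "\<dots> \<le> infsum f A * infsum g B"
    using F f g by (intro mult_mono finite_sum_le_infsum sum_nonneg infsum_nonneg) force+
  finally show "(\<Sum>(x, y)\<in>F. f x * g y) \<le> infsum f A * infsum g B" .
qed (use f g in auto)

lemma has_sum_sum:
  fixes f :: "'k \<Rightarrow> 'a \<Rightarrow> real"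
  assumes "finite K" "\<And>k. k \<in> K \<Longrightarrow> (f k has_sum s k) A"
  shows "((\<lambda>x. \<Sum>k\<in>K. f k x) has_sum (\<Sum>k\<in>K. s k)) A"
  using assms by (induction K rule: finite_induct) (auto intro!: has_sum_add)

text \<open>Extending \<open>g\<close> by 0 turns both sides into sums over \<open>A\<close>. The
  pointwise bound \<open>e\<close> then covers Taylor remainders on \<open>F\<close> and omitted
  tails off \<open>F\<close> at once.\<close>

lemma finite_sum_approx_infsum:
  fixes g :: "'a \<Rightarrow> real" and f :: "nat \<Rightarrow> 'a \<Rightarrow> real"
  assumes F: "finite F" "F \<subseteq> A" and f: "\<And>k. k < K \<Longrightarrow> f k summable_on A"
    and e: "e summable_on A" "infsum e A \<le> B"
    and approx: "\<And>x. x \<in> A \<Longrightarrow> \<bar>(if x \<in> F then g x else 0) - (\<Sum>k<K. f k x)\<bar> \<le> e x"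
  shows "\<bar>(\<Sum>x\<in>F. g x) - (\<Sum>k<K. infsum (f k) A)\<bar> \<le> B"
proof -
  have "((\<lambda>x. if x \<in> F then g x else 0) has_sum (\<Sum>x\<in>F. g x)) A \<longleftrightarrow> (g has_sum (\<Sum>x\<in>F. g x)) F"
    by (rule has_sum_cong_neutral) (use F in auto)
  hence 1: "((\<lambda>x. if x \<in> F then g x else 0) has_sum (\<Sum>x\<in>F. g x)) A" using F by simp
  have 2: "((\<lambda>x. \<Sum>k<K. f k x) has_sum (\<Sum>k<K. infsum (f k) A)) A"
    by (rule has_sum_sum) (use f in auto)
  have "((\<lambda>x. (if x \<in> F then g x else 0) - (\<Sum>k<K. f k x)) has_sum
      ((\<Sum>x\<in>F. g x) - (\<Sum>k<K. infsum (f k) A))) A"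
    using has_sum_add[OF 1 has_sum_cmult_right[OF 2, of "- 1"]] by simp
  from norm_infsum_le[OF this has_sum_infsum[OF e(1)]] approx e(2) show ?thesis by force
qed

text \<open>Comparison with an integral: the mean value theorem bounds each later term by a
  difference of values of \<open>t powr (1 - \<theta>)\<close>. The first term causes the summand 1
  in \<open>\<theta> / (\<theta> - 1) = 1 + 1 / (\<theta> - 1)\<close>.\<close>

lemma sum_powr_tail_le:
  fixes \<theta> :: real
  assumes "\<theta> > 1" "m \<ge> 1"
  shows "(\<Sum>u = m..N. real u powr - \<theta>) \<le> \<theta> / (\<theta> - 1) * real m powr (1 - \<theta>)"
proof -
  have incr: "real (Suc x) powr - \<theta> \<le> (real x powr (1 - \<theta>) - real (Suc x) powr (1 - \<theta>)) / (\<theta> - 1)"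
    if "x \<ge> 1" for x
  proof -
    have "\<exists>z. z > real x \<and> z < real (Suc x) \<and> (\<lambda>t. t powr (1 - \<theta>)) (real (Suc x)) - (\<lambda>t. t powr (1 - \<theta>)) (real x)
       = (real (Suc x) - real x) * ((1 - \<theta>) * z powr (1 - \<theta> - 1))"
    proof (rule MVT2)
      fix z assume "real x \<le> z"
      thus "((\<lambda>t. t powr (1 - \<theta>)) has_real_derivative (1 - \<theta>) * z powr (1 - \<theta> - 1)) (at z)"
        using that by (intro has_real_derivative_powr) auto
    qed simp
    then obtain z where z: "z > real x" "z < real (Suc x)"
      "real (Suc x) powr (1 - \<theta>) - real x powr (1 - \<theta>) = (1 - \<theta>) * z powr - \<theta>" by auto
    have "real (Suc x) powr - \<theta> \<le> z powr - \<theta>"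
      using z assms that by (intro powr_mono2') auto
    also have "\<dots> = (real x powr (1 - \<theta>) - real (Suc x) powr (1 - \<theta>)) / (\<theta> - 1)"
      using z(3) assms by (simp add: field_simps)
    finally show ?thesis .
  qed
  \<comment> \<open>The added boundary term lets the telescoping sum run as an induction.\<close>
  have "(\<Sum>u = m..N. real u powr - \<theta>) + real N powr (1 - \<theta>) / (\<theta> - 1) \<le> \<theta> / (\<theta> - 1) * real m powr (1 - \<theta>)"
    if "m \<le> N"
    using that
  proof (induction N rule: dec_induct)
    case base
    have "real m powr - \<theta> \<le> real m powr (1 - \<theta>)" using assms by (intro powr_mono) auto
    moreover have "\<theta> / (\<theta> - 1) = 1 + 1 / (\<theta> - 1)" using assms by (simp add: field_simps)
    ultimately show ?case by (simp add: algebra_simps)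
  next
    case (step x)
    have "real (Suc x) powr - \<theta> + real (Suc x) powr (1 - \<theta>) / (\<theta> - 1) \<le> real x powr (1 - \<theta>) / (\<theta> - 1)"
      using incr[of x] step.hyps assms by (simp add: diff_divide_distrib)
    thus ?case using step by simp
  qed
  moreover have "real N powr (1 - \<theta>) / (\<theta> - 1) \<ge> 0" using assms by simp
  moreover have "\<theta> / (\<theta> - 1) * real m powr (1 - \<theta>) \<ge> 0" using assms by simp
  ultimately show ?thesis by (cases "m \<le> N") (linarith, simp)
qed

lemma sum_powr_le: "\<theta> > 1 \<Longrightarrow> (\<Sum>u = 1..N. real u powr - \<theta>) \<le> \<theta> / (\<theta> - 1)"
  using sum_powr_tail_le[of \<theta> 1 N] by simp

lemma harm_le_ln: "n \<ge> 1 \<Longrightarrow> harm n \<le> 1 + ln (real n)"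
  using decseqD[OF decseq_harm_diff_ln, of 0 "n - 1"] by (simp add: harm_def)

text \<open>\<open>den\<close> is injective and \<open>v \<le> u\<close> on heads, so at most
  \<open>u\<close> heads share the first denominator \<open>u\<close>; this is the weight in the
  hypothesis.\<close>

lemma heads_summable:
  fixes g :: "nat \<Rightarrow> real"
  assumes g: "\<And>u. 0 \<le> g u" and B: "\<And>N. (\<Sum>u = 1..N. real u * g u) \<le> B"
  shows "(\<lambda>p. g (fst (den p))) summable_on heads" "infsum (\<lambda>p. g (fst (den p))) heads \<le> B"
proof -
  have fin: "(\<Sum>p\<in>F. g (fst (den p))) \<le> B" if F: "finite F" "F \<subseteq> heads" for F
  proof -
    obtain N where N: "\<And>p. p \<in> F \<Longrightarrow> fst (den p) \<le> N"
      using F(1) finite_nat_set_iff_bounded_le[of "(\<lambda>p. fst (den p)) ` F"] by auto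
    have "(\<Sum>p\<in>F. g (fst (den p))) = (\<Sum>z\<in>den ` F. g (fst z))"
      by (subst sum.reindex) (auto intro: inj_on_subset[OF inj_den])
    also have "\<dots> \<le> (\<Sum>z\<in>Sigma {1..N} (\<lambda>u. {1..u}). g (fst z))"
    proof (rule sum_mono2)
      show "den ` F \<subseteq> Sigma {1..N} (\<lambda>u. {1..u})"
      proof
        fix z assume "z \<in> den ` F"
        then obtain p where p: "p \<in> F" "z = den p" by blast
        hence "fst z \<in> {1..N}" "snd z \<in> {1..fst z}"
          using F N[of p] den_pos[of p] heads_den_le[of p] by (auto simp: Suc_le_eq)
        thus "z \<in> Sigma {1..N} (\<lambda>u. {1..u})" by (simp add: mem_Sigma_iff[of "fst z" "snd z", simplified])
      qed
    qed (use g in auto)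
    also have "\<dots> = (\<Sum>u = 1..N. real u * g u)"
      using sum.Sigma[of "{1..N}" "\<lambda>u. {1..u}" "\<lambda>u v. g u"] by (simp add: case_prod_unfold)
    finally show ?thesis using B[of N] by simp
  qed
  show "(\<lambda>p. g (fst (den p))) summable_on heads" "infsum (\<lambda>p. g (fst (den p))) heads \<le> B"
    using summable_on_bounded[OF _ fin] g by auto
qed

lemma heads_powr_summable:
  assumes "\<theta> > 2"
  shows "(\<lambda>p. real (fst (den p)) powr - \<theta>) summable_on heads"
proof (rule heads_summable(1))
  fix N
  have "real u * real u powr - \<theta> = real u powr - (\<theta> - 1)" if "u \<ge> 1" for u
    using that powr_add[of "real u" 1 "- \<theta>"] by (simp add: algebra_simps)
  hence "(\<Sum>u = 1..N. real u * real u powr - \<theta>) = (\<Sum>u = 1..N. real u powr - (\<theta> - 1))"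
    by (intro sum.cong) auto
  also have "\<dots> \<le> (\<theta> - 1) / (\<theta> - 1 - 1)" using assms by (intro sum_powr_le) auto
  finally show "(\<Sum>u = 1..N. real u * real u powr - \<theta>) \<le> (\<theta> - 1) / (\<theta> - 1 - 1)" .
qed auto

text \<open>Injectivity of \<open>den\<close> bounds finite sums by a product of two convergent
  power sums.\<close>

lemma area_powr_summable:
  assumes "\<theta> > 1"
  shows "(\<lambda>w. area w powr - \<theta>) summable_on UNIV"
proof (rule summable_on_bounded)
  fix F :: "bool list set" assume F: "finite F"
  obtain N where N: "\<And>p. p \<in> F \<Longrightarrow> fst (den p) \<le> N"
    using F(1) finite_nat_set_iff_bounded_le[of "(\<lambda>p. fst (den p)) ` F"] by auto
  obtain M where M: "\<And>p. p \<in> F \<Longrightarrow> snd (den p) \<le> M"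
    using F(1) finite_nat_set_iff_bounded_le[of "(\<lambda>p. snd (den p)) ` F"] by auto
  let ?g = "\<lambda>z. real (fst z) powr - \<theta> * real (snd z) powr - \<theta>"
  have "(\<Sum>p\<in>F. area p powr - \<theta>) = (\<Sum>z\<in>den ` F. ?g z)"
    by (subst sum.reindex) (auto intro: inj_on_subset[OF inj_den] simp: area_def powr_mult)
  also have "\<dots> \<le> (\<Sum>z\<in>{1..N} \<times> {1..M}. ?g z)"
  proof (rule sum_mono2)
    show "den ` F \<subseteq> {1..N} \<times> {1..M}"
    proof
      fix z assume "z \<in> den ` F"
      then obtain p where p: "p \<in> F" "z = den p" by blast
      thus "z \<in> {1..N} \<times> {1..M}"
        using N[of p] M[of p] den_pos[of p] by (auto simp: Suc_le_eq mem_Times_iff)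
    qed
  qed auto
  also have "\<dots> = (\<Sum>u = 1..N. real u powr - \<theta>) * (\<Sum>u = 1..M. real u powr - \<theta>)"
    by (simp add: sum_product sum.cartesian_product case_prod_unfold)
  also have "\<dots> \<le> \<theta> / (\<theta> - 1) * (\<theta> / (\<theta> - 1))"
    using assms by (intro mult_mono sum_powr_le sum_nonneg) auto
  finally show "(\<Sum>p\<in>F. area p powr - \<theta>) \<le> \<theta> / (\<theta> - 1) * (\<theta> / (\<theta> - 1))" .
qed auto

section \<open>Words ending in a long block\<close>

text \<open>For \<open>u\<close> at least the length of a head this dominates, up to a constant, both the Taylor
  remainder of order \<open>K\<close> (for short heads) and the omitted tails of the coefficient series
  (for long heads).\<close>

definition head_err :: "real \<Rightarrow> nat \<Rightarrow> nat \<Rightarrow> nat \<Rightarrow> real" where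
  "head_err \<beta> K n u = real u powr (- 2 * \<beta>) *
     (if 2 * u \<le> n then (2 * real u / real n) ^ K else (2 * real u / real n) ^ (K - 1))"

lemma head_err_nonneg: "0 \<le> head_err \<beta> K n u"
  by (simp add: head_err_def)

text \<open>\<open>K\<close> is the least integer with \<open>K \<ge> 2 * \<beta> - 2\<close>. For
  \<open>u \<le> n/2\<close> the weighted terms are at most a constant times
  \<open>n powr (2 - 2 * \<beta>) / u\<close>, which produces the logarithm; for larger
  \<open>u\<close> they decay like \<open>u powr - \<theta>\<close> with
  \<open>\<theta> > 1\<close>.\<close>

lemma head_err_sum_le:
  assumes \<beta>: "\<beta> > 1" and K: "K \<ge> 1" "2 * \<beta> - 2 \<le> real K" "real K < 2 * \<beta> - 1" and n: "n \<ge> 1"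
  shows "(\<Sum>u = 1..N. real u * head_err \<beta> K n u) \<le>
    (2 ^ K + 2 ^ K * (2 * \<beta> - K) / (2 * \<beta> - K - 1) * 2 powr (2 * \<beta>)) * (real n powr (2 - 2 * \<beta>) * (1 + ln (real n)))"
proof -
  define \<theta> where "\<theta> = 2 * \<beta> - real K"
  have \<theta>: "\<theta> > 1" "\<theta> \<le> 2 * \<beta>" using K by (auto simp: \<theta>_def)
  have n0: "real n > 0" using n by simp
  define m where "m = n div 2 + 1"
  have small: "real u * head_err \<beta> K n u \<le> 2 ^ K * real n powr (2 - 2 * \<beta>) * inverse (real u)"
    if "u \<ge> 1" "2 * u \<le> n" for u
  proof -
    have u0: "real u > 0" using that by simp
    have "real u * head_err \<beta> K n u = real u powr 1 * real u powr (- 2 * \<beta>) * (2 ^ K * real u powr real K * real n powr - real K)"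
      using that u0 n0 by (simp add: head_err_def power_divide power_mult_distrib powr_realpow powr_minus_divide)
    also have "\<dots> = 2 ^ K * real n powr - real K * (real u powr (K + 2 - 2 * \<beta>) * real u powr - 1)"
    proof -
      have "real u powr 1 * real u powr (- 2 * \<beta>) * real u powr real K = real u powr (K + 2 - 2 * \<beta>) * real u powr - 1"
        unfolding powr_add[symmetric] by (simp add: algebra_simps)
      from arg_cong[OF this, of "\<lambda>t. 2 ^ K * real n powr - real K * t"] show ?thesis
        by (simp only: mult_ac)
    qed
    \<comment> \<open>The exponent \<open>K + 2 - 2 * \<beta>\<close> is nonnegative, so
      \<open>u\<close> may be replaced by \<open>n\<close> in this power.\<close>
    also have "\<dots> \<le> 2 ^ K * real n powr - real K * (real n powr (K + 2 - 2 * \<beta>) * real u powr - 1)"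
      using that K by (intro mult_left_mono mult_right_mono powr_mono2) auto
    also have "\<dots> = 2 ^ K * real n powr (2 - 2 * \<beta>) * inverse (real u)"
    proof -
      have "real n powr - real K * real n powr (K + 2 - 2 * \<beta>) = real n powr (2 - 2 * \<beta>)"
        by (simp flip: powr_add)
      thus ?thesis using u0 by (simp add: powr_minus mult_ac)
    qed
    finally show ?thesis .
  qed
  have large: "real u * head_err \<beta> K n u = 2 ^ (K - 1) * real n powr (1 - real K) * real u powr - \<theta>"
    if "\<not> 2 * u \<le> n" for u
  proof -
    have u0: "real u > 0" using that by (cases u) auto
    have K1: "real (K - 1) = real K - 1" using K by simp
    have "real u * head_err \<beta> K n u = real u powr 1 * real u powr (- 2 * \<beta>) *
        (2 ^ (K - 1) * real u powr real (K - 1) * real n powr - real (K - 1))"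
      using that u0 n0
      by (simp add: head_err_def power_divide power_mult_distrib powr_realpow powr_minus_divide del: of_nat_diff)
    also have "\<dots> = 2 ^ (K - 1) * real n powr (1 - real K) * real u powr - \<theta>"
    proof -
      have 1: "real u powr 1 * real u powr (- 2 * \<beta>) * real u powr real (K - 1) = real u powr - \<theta>"
        unfolding powr_add[symmetric] K1 \<theta>_def by (simp add: algebra_simps)
      have 2: "real n powr - real (K - 1) = real n powr (1 - real K)" unfolding K1 by simp
      show ?thesis unfolding 1[symmetric] 2[symmetric] by (simp only: mult_ac)
    qed
    finally show ?thesis .
  qed
  have nonneg: "0 \<le> real u * head_err \<beta> K n u" for u by (simp add: head_err_nonneg)
  have "(\<Sum>u = 1..N. real u * head_err \<beta> K n u) \<le>
    (\<Sum>u\<in>{u\<in>{1..N}. 2 * u \<le> n}. real u * head_err \<beta> K n u) + (\<Sum>u\<in>{u\<in>{1..N}. \<not> 2 * u \<le> n}. real u * head_err \<beta> K n u)"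
    by (subst sum.union_disjoint[symmetric]) (auto intro!: sum_mono2 nonneg)
  also have "(\<Sum>u\<in>{u\<in>{1..N}. 2 * u \<le> n}. real u * head_err \<beta> K n u) \<le>
     (\<Sum>u\<in>{u\<in>{1..N}. 2 * u \<le> n}. 2 ^ K * real n powr (2 - 2 * \<beta>) * inverse (real u))"
    by (intro sum_mono small) auto
  also have "\<dots> \<le> (\<Sum>u = 1..n. 2 ^ K * real n powr (2 - 2 * \<beta>) * inverse (real u))"
    by (intro sum_mono2) auto
  also have "\<dots> = 2 ^ K * real n powr (2 - 2 * \<beta>) * harm n"
    by (simp add: harm_def sum_distrib_left)
  also have "\<dots> \<le> 2 ^ K * real n powr (2 - 2 * \<beta>) * (1 + ln (real n))"
    using n by (intro mult_left_mono harm_le_ln) auto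
  also have "(\<Sum>u\<in>{u\<in>{1..N}. \<not> 2 * u \<le> n}. real u * head_err \<beta> K n u) =
     (\<Sum>u\<in>{u\<in>{1..N}. \<not> 2 * u \<le> n}. 2 ^ (K - 1) * real n powr (1 - real K) * real u powr - \<theta>)"
    by (intro sum.cong refl large) auto
  also have "\<dots> \<le> (\<Sum>u = m..N. 2 ^ (K - 1) * real n powr (1 - real K) * real u powr - \<theta>)"
    by (intro sum_mono2) (auto simp: m_def)
  also have "\<dots> = 2 ^ (K - 1) * real n powr (1 - real K) * (\<Sum>u = m..N. real u powr - \<theta>)"
    by (simp add: sum_distrib_left)
  also have "\<dots> \<le> 2 ^ (K - 1) * real n powr (1 - real K) * (\<theta> / (\<theta> - 1) * real m powr (1 - \<theta>))"
    using \<theta> by (intro mult_left_mono sum_powr_tail_le) (auto simp: m_def)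
  also have "\<dots> \<le> 2 ^ K * real n powr (1 - real K) * (\<theta> / (\<theta> - 1) * (2 powr (2 * \<beta>) * real n powr (1 - \<theta>)))"
  proof (intro mult_mono mult_left_mono)
    have "real n / 2 \<le> real m" unfolding m_def by linarith
    hence "real m powr (1 - \<theta>) \<le> (real n / 2) powr (1 - \<theta>)"
      using \<theta> n0 by (intro powr_mono2') auto
    also have "\<dots> = 2 powr (\<theta> - 1) * real n powr (1 - \<theta>)"
      by (simp add: powr_divide powr_diff)
    also have "\<dots> \<le> 2 powr (2 * \<beta>) * real n powr (1 - \<theta>)"
      using \<theta> by (intro mult_right_mono powr_mono) auto
    finally show "real m powr (1 - \<theta>) \<le> 2 powr (2 * \<beta>) * real n powr (1 - \<theta>)" .
    show "(2 :: real) ^ (K - 1) \<le> 2 ^ K" by (intro power_increasing) auto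
  qed (use \<theta> in auto)
  also have "\<dots> = 2 ^ K * \<theta> / (\<theta> - 1) * 2 powr (2 * \<beta>) * real n powr (2 - 2 * \<beta>) * 1"
  proof -
    have "real n powr (1 - real K) * real n powr (1 - \<theta>) = real n powr (2 - 2 * \<beta>)"
      by (simp add: \<theta>_def flip: powr_add)
    thus ?thesis by (simp add: mult_ac)
  qed
  also have "\<dots> \<le> 2 ^ K * \<theta> / (\<theta> - 1) * 2 powr (2 * \<beta>) * real n powr (2 - 2 * \<beta>) * (1 + ln (real n))"
    using \<theta> n by (intro mult_left_mono) auto
  finally show ?thesis by (simp add: \<theta>_def algebra_simps)
qed

text \<open>\<open>u\<close> exceeds the length of the head, so passing from the length to
  \<open>u\<close> enlarges each power.\<close>

lemma head_err_ge:
  assumes "p \<in> heads" "n \<ge> 1" "K \<ge> 1"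
  defines "z \<equiv> real (Suc (length p)) / real n"
  shows "real (fst (den p)) powr (- 2 * \<beta>) * (if 2 * Suc (length p) \<le> n then (2 * z) ^ K else (2 * z) ^ (K - 1))
     \<le> head_err \<beta> K n (fst (den p))"
  unfolding head_err_def
proof (rule mult_left_mono)
  define u where "u = fst (den p)"
  have su: "Suc (length p) \<le> u" using heads_length_less[OF assms(1)] by (simp add: u_def)
  have z: "0 \<le> 2 * z" "2 * z \<le> 2 * real u / real n"
    using su assms(2) by (simp_all add: z_def divide_right_mono)
  show "(if 2 * Suc (length p) \<le> n then (2 * z) ^ K else (2 * z) ^ (K - 1)) \<le>
    (if 2 * fst (den p) \<le> n then (2 * real (fst (den p)) / real n) ^ K else (2 * real (fst (den p)) / real n) ^ (K - 1))"
    unfolding u_def[symmetric]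
  \<comment> \<open>The one mixed case is a short head with a large \<open>u\<close>: the two sides
    then carry different exponents, but 1 lies between them.\<close>
  proof (cases "2 * Suc (length p) \<le> n \<and> \<not> 2 * u \<le> n")
    case True
    have "2 * z \<le> 1" using True assms(2) unfolding z_def by (simp add: field_simps)
    hence "(2 * z) ^ K \<le> 1" using z by (intro power_le_one) auto
    moreover have "1 \<le> 2 * real u / real n" using True assms(2) by (simp add: field_simps)
    hence "1 \<le> (2 * real u / real n) ^ (K - 1)" by (rule one_le_power)
    ultimately have "(2 * z) ^ K \<le> (2 * real u / real n) ^ (K - 1)" by (rule order_trans)
    thus "(if 2 * Suc (length p) \<le> n then (2 * z) ^ K else (2 * z) ^ (K - 1)) \<le>
      (if 2 * u \<le> n then (2 * real u / real n) ^ K else (2 * real u / real n) ^ (K - 1))"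
      using True by simp
  next
    case False
    thus "(if 2 * Suc (length p) \<le> n then (2 * z) ^ K else (2 * z) ^ (K - 1)) \<le>
      (if 2 * u \<le> n then (2 * real u / real n) ^ K else (2 * real u / real n) ^ (K - 1))"
      using su power_mono[OF z(2,1), of K] power_mono[OF z(2,1), of "K - 1"] by auto
  qed
qed simp

text \<open>The word with \<open>p\<close> followed by a final block, at level \<open>n\<close>, has area \<open>u\<^sup>2 (n - lag p)\<close>,
  where \<open>(u, v) = den p\<close>. Similarly \<open>lag_left\<close> and \<open>lag_right\<close> below give the two factors of the
  area when the block is followed by \<open>True\<close> and then \<open>r\<close>.\<close>

definition lag :: "bool list \<Rightarrow> real" where
  "lag p = real (Suc (length p)) - real (snd (den p)) / real (fst (den p))"

text \<open>Half of \<open>C\<^sub>k\<close>, since complementary words contribute equally. The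
  second argument of \<open>hom_part\<close> is 0 because only one factor of the area grows with a
  final block.\<close>

definition coef_last :: "real \<Rightarrow> nat \<Rightarrow> real" where
  "coef_last \<beta> k = infsum (\<lambda>p. real (fst (den p)) powr (- 2 * \<beta>) * hom_part \<beta> k (lag p) 0) heads"

lemma heads_ratio_le_1: "p \<in> heads \<Longrightarrow> real (snd (den p)) / real (fst (den p)) \<le> 1"
  using heads_den_le[of p] den_pos[of p] by simp

lemma lag_bounds: "p \<in> heads \<Longrightarrow> 0 \<le> lag p" "p \<in> heads \<Longrightarrow> lag p \<le> real (Suc (length p))"
  using heads_ratio_le_1[of p] by (auto simp: lag_def)

text \<open>Level \<open>n\<close> has words of \<open>n - 1\<close> letters, so the block has
  \<open>n - 1 - length p\<close>. The factor \<open>(1 - 0) powr - \<beta>\<close> matches the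
  two-variable expansion at \<open>y = 0\<close>.\<close>

lemma area_block_last_powr:
  assumes "p \<in> heads" "Suc (length p) \<le> n"
  shows "area (replicate (n - Suc (length p)) False @ p) powr - \<beta> =
    real n powr - \<beta> * (real (fst (den p)) powr (- 2 * \<beta>) * ((1 - lag p / real n) powr - \<beta> * (1 - 0) powr - \<beta>))"
proof -
  have pos: "real (fst (den p)) > 0" "real n > 0" using den_pos[of p] assms(2) by auto
  have "area (replicate (n - Suc (length p)) False @ p) =
      real n * ((real (fst (den p)) * real (fst (den p))) * (1 - lag p / real n))"
    unfolding area_block_last lag_def using assms(2) pos by (simp add: of_nat_diff field_simps)
  moreover have "1 - lag p / real n \<ge> 0"
    using lag_bounds[OF assms(1)] assms(2) pos by (simp add: field_simps)
  ultimately show ?thesis using pos by (simp add: powr_mult flip: powr_add)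
qed

text \<open>\<open>lag p \<le> u\<close> makes the terms of order
  \<open>u powr (k - 2 * \<beta>)\<close>; with at most \<open>u\<close> heads for each
  \<open>u\<close>, the hypothesis on \<open>k\<close> gives convergence.\<close>

lemma coef_last_summable:
  assumes "\<beta> > 1" "real k < 2 * \<beta> - 2"
  shows "(\<lambda>p. real (fst (den p)) powr (- 2 * \<beta>) * hom_part \<beta> k (lag p) 0) summable_on heads"
proof (rule summable_on_comparison_test)
  show "(\<lambda>p. (4 powr \<beta> * 2 ^ k) * real (fst (den p)) powr - (2 * \<beta> - real k)) summable_on heads"
    using assms by (intro summable_on_cmult_right heads_powr_summable) auto
  fix p assume p: "p \<in> heads"
  have u: "real (fst (den p)) > 0" using den_pos by simp
  have "hom_part \<beta> k (lag p) 0 \<le> 4 powr \<beta> * (2 * real (Suc (length p))) ^ k"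
    using assms lag_bounds[OF p] by (intro hom_part_le) auto
  also have "\<dots> \<le> 4 powr \<beta> * (2 * real (fst (den p))) ^ k"
    using heads_length_less[OF p] by (intro mult_left_mono power_mono) auto
  finally have "real (fst (den p)) powr (- 2 * \<beta>) * hom_part \<beta> k (lag p) 0 \<le>
     real (fst (den p)) powr (- 2 * \<beta>) * (4 powr \<beta> * (2 * real (fst (den p))) ^ k)"
    by (intro mult_left_mono) auto
  also have "\<dots> = (4 powr \<beta> * 2 ^ k) * real (fst (den p)) powr - (2 * \<beta> - real k)"
    using u by (simp add: power_mult_distrib powr_diff powr_minus powr_realpow field_simps)
  finally show "real (fst (den p)) powr (- 2 * \<beta>) * hom_part \<beta> k (lag p) 0 \<le>
    (4 powr \<beta> * 2 ^ k) * real (fst (den p)) powr - (2 * \<beta> - real k)" .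
  show "0 \<le> real (fst (den p)) powr (- 2 * \<beta>) * hom_part \<beta> k (lag p) 0"
    using assms lag_bounds[OF p] by (intro mult_nonneg_nonneg hom_part_nonneg) auto
qed

lemma finite_short_words [simp]: "finite {p :: bool list. length p \<le> n}"
  using finite_lists_length_le[of "UNIV :: bool set" n] by simp

text \<open>On \<open>F\<close> the error is a Taylor remainder, elsewhere it is the tail of the
  coefficient series; \<open>head_err\<close> dominates both.\<close>

lemma block_last_expansion:
  assumes \<beta>: "\<beta> > 1" and K: "K \<ge> 1" "2 * \<beta> - 2 \<le> real K" "real K < 2 * \<beta> - 1" and n: "n \<ge> 1"
  defines "F \<equiv> {p \<in> heads. 2 * Suc (length p) \<le> n}"
  defines "B \<equiv> (2 ^ K + 2 ^ K * (2 * \<beta> - K) / (2 * \<beta> - K - 1) * 2 powr (2 * \<beta>)) * (real n powr (2 - 2 * \<beta>) * (1 + ln (real n)))"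
  shows "\<bar>(\<Sum>p\<in>F. area (replicate (n - Suc (length p)) False @ p) powr - \<beta>)
     - (\<Sum>k<K. coef_last \<beta> k / real n powr (\<beta> + real k))\<bar> \<le> real n powr - \<beta> * 4 powr \<beta> * B"
proof -
  have n0: "real n > 0" using n by simp
  let ?u = "\<lambda>p. real (fst (den p)) powr (- 2 * \<beta>)"
  have fF: "finite F" by (rule finite_subset[OF _ finite_short_words[of n]]) (auto simp: F_def)
  note hs = heads_summable[of "head_err \<beta> K n", OF head_err_nonneg head_err_sum_le[OF \<beta> K n, folded B_def]]
  have "\<bar>(\<Sum>p\<in>F. area (replicate (n - Suc (length p)) False @ p) powr - \<beta>)
     - (\<Sum>k<K. infsum (\<lambda>p. real n powr - \<beta> * (1 / real n ^ k) * (?u p * hom_part \<beta> k (lag p) 0)) heads)\<bar>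
     \<le> real n powr - \<beta> * 4 powr \<beta> * B"
  proof (rule finite_sum_approx_infsum[OF fF])
    show "F \<subseteq> heads" by (auto simp: F_def)
    show "(\<lambda>p. real n powr - \<beta> * (1 / real n ^ k) * (?u p * hom_part \<beta> k (lag p) 0)) summable_on heads" if "k < K" for k
      using that K by (intro summable_on_cmult_right coef_last_summable \<beta>) auto
    show "(\<lambda>p. (real n powr - \<beta> * 4 powr \<beta>) * head_err \<beta> K n (fst (den p))) summable_on heads"
      by (intro summable_on_cmult_right hs(1))
    show "infsum (\<lambda>p. (real n powr - \<beta> * 4 powr \<beta>) * head_err \<beta> K n (fst (den p))) heads \<le> real n powr - \<beta> * 4 powr \<beta> * B"
      using hs(2) by (subst infsum_cmult_right') (intro mult_left_mono, auto)
  next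
    fix p assume p: "p \<in> heads"
    define z where "z = real (Suc (length p)) / real n"
    define x where "x = lag p / real n"
    have x: "0 \<le> x" "x \<le> z" "0 \<le> z"
      using lag_bounds[OF p] n0 by (simp_all add: x_def z_def divide_right_mono)
    have hp: "1 / real n ^ k * hom_part \<beta> k (lag p) 0 = hom_part \<beta> k x 0" for k
      using hom_part_divide[of \<beta> k "lag p" "real n" 0] by (simp add: x_def)
    have S: "(\<Sum>k<K. real n powr - \<beta> * (1 / real n ^ k) * (?u p * hom_part \<beta> k (lag p) 0)) =
        real n powr - \<beta> * (?u p * (\<Sum>k<K. hom_part \<beta> k x 0))"
      unfolding hp[symmetric] sum_distrib_left by (intro sum.cong) (simp_all add: mult_ac)
    have main: "\<bar>(if p \<in> F then (1 - x) powr - \<beta> * (1 - 0) powr - \<beta> else 0) - (\<Sum>k<K. hom_part \<beta> k x 0)\<bar>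
        \<le> 4 powr \<beta> * (if 2 * Suc (length p) \<le> n then (2 * z) ^ K else (2 * z) ^ (K - 1))"
    proof (cases "2 * Suc (length p) \<le> n")
      case True
      have "real (2 * Suc (length p)) \<le> real n" using True of_nat_le_iff by blast
      hence "z \<le> 1/2" using n0 unfolding z_def by (simp add: field_simps)
      thus ?thesis using True p hom_part_remainder[of \<beta> x 0 z K] \<beta> x by (simp add: F_def)
    next
      case False
      hence "real n \<le> real (2 * Suc (length p))" using of_nat_le_iff by (metis nat_le_linear)
      hence "1/2 \<le> z" using n0 unfolding z_def by (simp add: field_simps)
      moreover have "(\<Sum>k<K. hom_part \<beta> k x 0) \<ge> 0" using x \<beta> by (intro sum_nonneg hom_part_nonneg) auto
      \<comment> \<open>Long heads are charged with the exponent \<open>K - 1\<close> only: the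
        power \<open>K\<close> would diverge when summed over all heads.\<close>
      ultimately show ?thesis using False sum_hom_part_le_large[of \<beta> x 0 z K "K - 1"] \<beta> x K by (simp add: F_def)
    qed
    have "(if p \<in> F then area (replicate (n - Suc (length p)) False @ p) powr - \<beta> else 0)
        - (\<Sum>k<K. real n powr - \<beta> * (1 / real n ^ k) * (?u p * hom_part \<beta> k (lag p) 0))
      = real n powr - \<beta> * (?u p * ((if p \<in> F then (1 - x) powr - \<beta> * (1 - 0) powr - \<beta> else 0) - (\<Sum>k<K. hom_part \<beta> k x 0)))"
      unfolding S using area_block_last_powr[OF p, of n \<beta>]
      by (simp add: F_def x_def algebra_simps)
    also have "\<bar>\<dots>\<bar> = real n powr - \<beta> * (?u p * \<bar>(if p \<in> F then (1 - x) powr - \<beta> * (1 - 0) powr - \<beta> else 0) - (\<Sum>k<K. hom_part \<beta> k x 0)\<bar>)"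
      by (simp add: abs_mult)
    also have "\<dots> \<le> real n powr - \<beta> * (?u p * (4 powr \<beta> * (if 2 * Suc (length p) \<le> n then (2 * z) ^ K else (2 * z) ^ (K - 1))))"
      by (intro mult_left_mono main) auto
    also have "\<dots> = real n powr - \<beta> * 4 powr \<beta> * (?u p * (if 2 * Suc (length p) \<le> n then (2 * z) ^ K else (2 * z) ^ (K - 1)))"
      by (simp only: mult_ac)
    also have "\<dots> \<le> real n powr - \<beta> * 4 powr \<beta> * head_err \<beta> K n (fst (den p))"
      using head_err_ge[OF p n K(1), of \<beta>] unfolding z_def by (intro mult_left_mono) auto
    finally show "\<bar>(if p \<in> F then area (replicate (n - Suc (length p)) False @ p) powr - \<beta> else 0)
        - (\<Sum>k<K. real n powr - \<beta> * (1 / real n ^ k) * (?u p * hom_part \<beta> k (lag p) 0))\<bar>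
        \<le> real n powr - \<beta> * 4 powr \<beta> * head_err \<beta> K n (fst (den p))" .
  qed
  also have "(\<Sum>k<K. infsum (\<lambda>p. real n powr - \<beta> * (1 / real n ^ k) * (?u p * hom_part \<beta> k (lag p) 0)) heads)
      = (\<Sum>k<K. coef_last \<beta> k / real n powr (\<beta> + real k))"
    unfolding coef_last_def infsum_cmult_right'
    using n0 by (intro sum.cong) (simp_all add: powr_add powr_minus powr_realpow field_simps)
  finally show ?thesis .
qed

section \<open>Words with a long inner block\<close>

definition lag_left :: "bool list \<Rightarrow> bool list \<Rightarrow> real" where
  "lag_left p r = lag p + (real (Suc (length r)) - real (fst (act r (1, 0))) / real (fst (den r)))"

definition lag_right :: "bool list \<Rightarrow> bool list \<Rightarrow> real" where
  "lag_right p r = lag p + (real (Suc (length r)) - real (snd (act r (1, 0))) / real (snd (den r)))"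

text \<open>What remains of a contribution when \<open>n powr (- 2 * \<beta>)\<close> and the powers
  of \<open>1 - lag_left p r / n\<close> and \<open>1 - lag_right p r / n\<close> are taken
  out.\<close>

definition inner_weight :: "real \<Rightarrow> bool list \<Rightarrow> bool list \<Rightarrow> real" where
  "inner_weight \<beta> p r = real (fst (den p)) powr (- 2 * \<beta>) * area r powr - \<beta>"

definition coef_inner :: "real \<Rightarrow> nat \<Rightarrow> real" where
  "coef_inner \<beta> k =
     infsum (\<lambda>(p, r). inner_weight \<beta> p r * hom_part \<beta> k (lag_left p r) (lag_right p r)) (heads \<times> UNIV)"

text \<open>Both lags are at most \<open>length p + length r + 2\<close>, so this moment bounds
  remainders and tails alike.\<close>

definition inner_moment :: "real \<Rightarrow> nat \<Rightarrow> real" where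
  "inner_moment \<beta> K =
     infsum (\<lambda>(p, r). inner_weight \<beta> p r * real (length p + length r + 2) ^ K) (heads \<times> UNIV)"

lemma inner_weight_nonneg: "0 \<le> inner_weight \<beta> p r"
  by (simp add: inner_weight_def)

lemma lag_inner_bounds:
  assumes "p \<in> heads"
  shows "0 \<le> lag_left p r" "lag_left p r \<le> real (length p + length r + 2)"
    "0 \<le> lag_right p r" "lag_right p r \<le> real (length p + length r + 2)"
proof -
  have "real (fst (act r (1, 0))) / real (fst (den r)) \<le> 1" "real (snd (act r (1, 0))) / real (snd (den r)) \<le> 1"
    using act_one_zero_le[of r] den_pos[of r] by auto
  moreover have "real (fst (act r (1, 0))) / real (fst (den r)) \<ge> 0" "real (snd (act r (1, 0))) / real (snd (den r)) \<ge> 0"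
    by auto
  moreover have "real (length p + length r + 2) = real (Suc (length p)) + real (Suc (length r))" by simp
  moreover have "real (Suc (length r)) \<ge> 1" by simp
  ultimately show "0 \<le> lag_left p r" "lag_left p r \<le> real (length p + length r + 2)"
    "0 \<le> lag_right p r" "lag_right p r \<le> real (length p + length r + 2)"
    using lag_bounds[OF assms] unfolding lag_left_def lag_right_def by linarith+
qed

text \<open>With \<open>(c, d) = den r\<close> the two factors of the area are
  \<open>c u (n - lag_left p r)\<close> and \<open>d u (n - lag_right p r)\<close>.\<close>

lemma area_block_inner_powr:
  assumes p: "p \<in> heads" and n: "length p + length r + 2 \<le> n"
  shows "area (r @ True # replicate (n - (length p + length r + 2)) False @ p) powr - \<beta> =
    real n powr (- 2 * \<beta>) * (inner_weight \<beta> p r *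
      ((1 - lag_left p r / real n) powr - \<beta> * (1 - lag_right p r / real n) powr - \<beta>))"
proof -
  define u v c d \<alpha> \<gamma> where "u = real (fst (den p))" and "v = real (snd (den p))"
    and "c = real (fst (den r))" and "d = real (snd (den r))"
    and "\<alpha> = real (fst (act r (1, 0)))" and "\<gamma> = real (snd (act r (1, 0)))"
  note defs = u_def v_def c_def d_def \<alpha>_def \<gamma>_def
  have pos: "u > 0" "c > 0" "d > 0" "real n > 0" using den_pos[of p] den_pos[of r] n by (auto simp: defs)
  have a: "real (n - (length p + length r + 2)) = real n - real (Suc (length p)) - real (Suc (length r))"
    using n by (simp add: of_nat_diff)
  have "c * (v + (real n - real (Suc (length p)) - real (Suc (length r))) * u) + \<alpha> * u
      = real n * (c * u * (1 - lag_left p r / real n))"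
    using pos unfolding lag_left_def lag_def defs[symmetric] by (simp add: field_simps)
  moreover have "d * (v + (real n - real (Suc (length p)) - real (Suc (length r))) * u) + \<gamma> * u
      = real n * (d * u * (1 - lag_right p r / real n))"
    using pos unfolding lag_right_def lag_def defs[symmetric] by (simp add: field_simps)
  ultimately have "area (r @ True # replicate (n - (length p + length r + 2)) False @ p) =
     (real n * real n) * ((u * u) * (c * d) * ((1 - lag_left p r / real n) * (1 - lag_right p r / real n)))"
    unfolding area_block_inner a defs[symmetric] by (simp only: mult_ac)
  moreover have "0 \<le> 1 - lag_left p r / real n" "0 \<le> 1 - lag_right p r / real n"
    using lag_inner_bounds[OF p, of r] n pos by (simp_all add: field_simps)
  ultimately show ?thesis using pos
    by (simp add: powr_mult inner_weight_def area_def mult_ac flip: powr_add defs)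
qed

text \<open>With \<open>s\<close>, \<open>t\<close> the two lengths plus one:
  \<open>s + t \<le> 2 s t\<close>, \<open>s \<le> u\<close> and \<open>t \<le> area r\<close>. The
  bound is a product, so the sums over \<open>p\<close> and \<open>r\<close> separate.\<close>

lemma inner_weight_moment_le:
  assumes "p \<in> heads"
  shows "inner_weight \<beta> p r * real (length p + length r + 2) ^ K \<le>
    2 ^ K * (real (fst (den p)) powr - (2 * \<beta> - real K) * area r powr - (\<beta> - real K))"
proof -
  have u: "real (fst (den p)) > 0" "area r > 0" using den_pos area_pos by simp_all
  have s: "real (Suc (length p)) \<le> real (fst (den p))" using heads_length_less[OF assms] by simp
  have t: "real (Suc (length r)) \<le> area r" by (rule length_less_area)
  have "length p + length r + 2 \<le> 2 * (Suc (length p) * Suc (length r))" by simp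
  hence "real (length p + length r + 2) \<le> 2 * (real (Suc (length p)) * real (Suc (length r)))"
    by (metis of_nat_le_iff of_nat_mult of_nat_numeral)
  also have "\<dots> \<le> 2 * (real (fst (den p)) * area r)"
    using s t by (intro mult_left_mono mult_mono) auto
  finally have "inner_weight \<beta> p r * real (length p + length r + 2) ^ K \<le>
      inner_weight \<beta> p r * (2 * (real (fst (den p)) * area r)) ^ K"
    by (intro mult_left_mono power_mono inner_weight_nonneg) auto
  also have "\<dots> = 2 ^ K * (real (fst (den p)) powr - (2 * \<beta> - real K) * area r powr - (\<beta> - real K))"
    using u by (simp add: inner_weight_def power_mult_distrib powr_diff powr_minus powr_realpow field_simps)
  finally show ?thesis .
qed

lemma inner_moment_summable:
  assumes "\<beta> > 1" "real K < \<beta> - 1"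
  shows "(\<lambda>(p, r). inner_weight \<beta> p r * real (length p + length r + 2) ^ K) summable_on heads \<times> UNIV"
proof (rule summable_on_comparison_test)
  have "(\<lambda>(p, r). real (fst (den p)) powr - (2 * \<beta> - real K) * area r powr - (\<beta> - real K)) summable_on heads \<times> UNIV"
    using assms by (intro summable_on_times heads_powr_summable area_powr_summable) auto
  thus "(\<lambda>z. 2 ^ K * (\<lambda>(p, r). real (fst (den p)) powr - (2 * \<beta> - real K) * area r powr - (\<beta> - real K)) z) summable_on heads \<times> UNIV"
    by (rule summable_on_cmult_right)
next
  fix z :: "bool list \<times> bool list" assume "z \<in> heads \<times> UNIV"
  then obtain p r where z: "z = (p, r)" "p \<in> heads" by auto
  show "(\<lambda>(p, r). inner_weight \<beta> p r * real (length p + length r + 2) ^ K) z \<le>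
    2 ^ K * (\<lambda>(p, r). real (fst (den p)) powr - (2 * \<beta> - real K) * area r powr - (\<beta> - real K)) z"
    using inner_weight_moment_le[OF z(2), of \<beta> r K] by (simp add: z)
  show "0 \<le> (\<lambda>(p, r). inner_weight \<beta> p r * real (length p + length r + 2) ^ K) z"
    by (simp add: z inner_weight_nonneg)
qed

lemma coef_inner_summable:
  assumes "\<beta> > 1" "real k < \<beta> - 1"
  shows "(\<lambda>(p, r). inner_weight \<beta> p r * hom_part \<beta> k (lag_left p r) (lag_right p r)) summable_on heads \<times> UNIV"
proof (rule summable_on_comparison_test)
  show "(\<lambda>z. (4 powr \<beta> * 2 ^ k) * (\<lambda>(p, r). inner_weight \<beta> p r * real (length p + length r + 2) ^ k) z) summable_on heads \<times> UNIV"
    by (intro summable_on_cmult_right inner_moment_summable assms)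
next
  fix z :: "bool list \<times> bool list" assume "z \<in> heads \<times> UNIV"
  then obtain p r where z: "z = (p, r)" "p \<in> heads" by auto
  note b = lag_inner_bounds[OF z(2), of r]
  have "hom_part \<beta> k (lag_left p r) (lag_right p r) \<le> 4 powr \<beta> * (2 * real (length p + length r + 2)) ^ k"
    using b assms by (intro hom_part_le) auto
  from mult_left_mono[OF this inner_weight_nonneg[of \<beta> p r]]
  show "(\<lambda>(p, r). inner_weight \<beta> p r * hom_part \<beta> k (lag_left p r) (lag_right p r)) z \<le>
    (4 powr \<beta> * 2 ^ k) * (\<lambda>(p, r). inner_weight \<beta> p r * real (length p + length r + 2) ^ k) z"
    unfolding z by (simp only: power_mult_distrib case_prod_conv mult_ac)
  show "0 \<le> (\<lambda>(p, r). inner_weight \<beta> p r * hom_part \<beta> k (lag_left p r) (lag_right p r)) z"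
    using b assms by (simp add: z inner_weight_nonneg hom_part_nonneg)
qed

text \<open>Here the moment of full order \<open>K\<close> converges, so one power covers short and
  long words, and no logarithm arises.\<close>

lemma block_inner_expansion:
  assumes \<beta>: "\<beta> > 1" and K: "real K < \<beta> - 1" and n: "n \<ge> 1"
  defines "F \<equiv> {(p, r). p \<in> heads \<and> 2 * (length p + length r + 2) \<le> n}"
  shows "\<bar>(\<Sum>(p, r)\<in>F. area (r @ True # replicate (n - (length p + length r + 2)) False @ p) powr - \<beta>)
     - (\<Sum>k<K. coef_inner \<beta> k / real n powr (2 * \<beta> + real k))\<bar>
    \<le> real n powr (- 2 * \<beta>) * 4 powr \<beta> * (2 / real n) ^ K * inner_moment \<beta> K"
proof -
  have n0: "real n > 0" using n by simp
  have fF: "finite F"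
    by (rule finite_subset[OF _ finite_cartesian_product[OF finite_short_words[of n] finite_short_words[of n]]])
      (auto simp: F_def)
  let ?H = "\<lambda>k (p, r). inner_weight \<beta> p r * hom_part \<beta> k (lag_left p r) (lag_right p r)"
  let ?M = "\<lambda>(p, r). inner_weight \<beta> p r * real (length p + length r + 2) ^ K"
  let ?c = "real n powr (- 2 * \<beta>) * 4 powr \<beta> * (2 / real n) ^ K"
  have "\<bar>(\<Sum>z\<in>F. (\<lambda>(p, r). area (r @ True # replicate (n - (length p + length r + 2)) False @ p) powr - \<beta>) z)
     - (\<Sum>k<K. infsum (\<lambda>z. real n powr (- 2 * \<beta>) * (1 / real n ^ k) * ?H k z) (heads \<times> UNIV))\<bar>
     \<le> ?c * inner_moment \<beta> K"
  proof (rule finite_sum_approx_infsum[OF fF])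
    show "F \<subseteq> heads \<times> UNIV" by (auto simp: F_def)
    show "(\<lambda>z. real n powr (- 2 * \<beta>) * (1 / real n ^ k) * ?H k z) summable_on heads \<times> UNIV" if "k < K" for k
      using that K by (intro summable_on_cmult_right coef_inner_summable \<beta>) auto
    show "(\<lambda>z. ?c * ?M z) summable_on heads \<times> UNIV"
      by (intro summable_on_cmult_right inner_moment_summable \<beta> K)
    show "infsum (\<lambda>z. ?c * ?M z) (heads \<times> UNIV) \<le> ?c * inner_moment \<beta> K"
      by (simp add: infsum_cmult_right' inner_moment_def)
  next
    fix w :: "bool list \<times> bool list" assume "w \<in> heads \<times> UNIV"
    then obtain p r where w: "w = (p, r)" and p: "p \<in> heads" by auto
    define z where "z = real (length p + length r + 2) / real n"
    define x where "x = lag_left p r / real n"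
    define y where "y = lag_right p r / real n"
    define W where "W = inner_weight \<beta> p r"
    have W: "W \<ge> 0" by (simp add: W_def inner_weight_nonneg)
    have x: "0 \<le> x" "x \<le> z" "0 \<le> y" "y \<le> z"
      using lag_inner_bounds[OF p, of r] n0 by (simp_all add: x_def y_def z_def divide_right_mono)
    have hp: "1 / real n ^ k * hom_part \<beta> k (lag_left p r) (lag_right p r) = hom_part \<beta> k x y" for k
      using hom_part_divide[of \<beta> k "lag_left p r" "real n" "lag_right p r"] by (simp add: x_def y_def)
    have S: "(\<Sum>k<K. real n powr (- 2 * \<beta>) * (1 / real n ^ k) * ?H k w) =
        real n powr (- 2 * \<beta>) * (W * (\<Sum>k<K. hom_part \<beta> k x y))"
      unfolding hp[symmetric] sum_distrib_left w W_def by (intro sum.cong) (simp_all add: mult_ac)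
    have iff: "w \<in> F \<longleftrightarrow> 2 * (length p + length r + 2) \<le> n" using p by (simp add: F_def w)
    define T where "T = (if w \<in> F then (1 - x) powr - \<beta> * (1 - y) powr - \<beta> else 0)"
    have main: "\<bar>T - (\<Sum>k<K. hom_part \<beta> k x y)\<bar> \<le> 4 powr \<beta> * (2 * z) ^ K"
    proof (cases "w \<in> F")
      case True
      hence "real (2 * (length p + length r + 2)) \<le> real n" unfolding iff using of_nat_le_iff by blast
      hence "z \<le> 1/2" using n0 unfolding z_def by (simp add: field_simps)
      thus ?thesis using True hom_part_remainder[of \<beta> x y z K] \<beta> x by (simp add: T_def)
    next
      case False
      hence "real n \<le> real (2 * (length p + length r + 2))" unfolding iff using of_nat_le_iff by (metis nat_le_linear)
      hence "1/2 \<le> z" using n0 unfolding z_def by (simp add: field_simps)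
      moreover have "(\<Sum>k<K. hom_part \<beta> k x y) \<ge> 0" using x \<beta> by (intro sum_nonneg hom_part_nonneg) auto
      ultimately show ?thesis using False sum_hom_part_le_large[of \<beta> x y z K K] \<beta> x by (simp add: T_def)
    qed
    have "(if w \<in> F then (\<lambda>(p, r). area (r @ True # replicate (n - (length p + length r + 2)) False @ p) powr - \<beta>) w else 0)
        = real n powr (- 2 * \<beta>) * (W * T)"
      using area_block_inner_powr[OF p, of r n \<beta>] iff by (auto simp: w T_def W_def x_def y_def)
    hence "(if w \<in> F then (\<lambda>(p, r). area (r @ True # replicate (n - (length p + length r + 2)) False @ p) powr - \<beta>) w else 0)
        - (\<Sum>k<K. real n powr (- 2 * \<beta>) * (1 / real n ^ k) * ?H k w)
      = real n powr (- 2 * \<beta>) * (W * (T - (\<Sum>k<K. hom_part \<beta> k x y)))"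
      unfolding S by (simp only: right_diff_distrib)
    also have "\<bar>\<dots>\<bar> = real n powr (- 2 * \<beta>) * (W * \<bar>T - (\<Sum>k<K. hom_part \<beta> k x y)\<bar>)"
      using W by (simp add: abs_mult)
    also have "\<dots> \<le> real n powr (- 2 * \<beta>) * (W * (4 powr \<beta> * (2 * z) ^ K))"
      using W by (intro mult_left_mono main) auto
    also have "\<dots> = ?c * ?M w"
      unfolding w z_def W_def case_prod_conv times_divide_eq_right power_mult_distrib power_divide
      by (simp only: times_divide_eq_left times_divide_eq_right mult_ac)
    finally show "\<bar>(if w \<in> F then (\<lambda>(p, r). area (r @ True # replicate (n - (length p + length r + 2)) False @ p) powr - \<beta>) w else 0)
        - (\<Sum>k<K. real n powr (- 2 * \<beta>) * (1 / real n ^ k) * ?H k w)\<bar> \<le> ?c * ?M w" .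
  qed
  also have "(\<Sum>k<K. infsum (\<lambda>z. real n powr (- 2 * \<beta>) * (1 / real n ^ k) * ?H k z) (heads \<times> UNIV))
      = (\<Sum>k<K. coef_inner \<beta> k / real n powr (2 * \<beta> + real k))"
    unfolding coef_inner_def infsum_cmult_right'
    using n0 by (intro sum.cong) (simp_all add: powr_add powr_minus powr_realpow field_simps)
  finally show ?thesis by (simp add: case_prod_unfold)
qed

section \<open>Positivity of the coefficients and value of the leading one\<close>

lemma infsum_pos:
  fixes f :: "'a \<Rightarrow> real"
  assumes "f summable_on A" "\<And>x. x \<in> A \<Longrightarrow> 0 \<le> f x" "a \<in> A" "0 < f a"
  shows "0 < infsum f A"
  using finite_sum_le_infsum[OF assms(1), of "{a}"] assms by force

lemma coef_last_pos:
  assumes "\<beta> > 1" "real k < 2 * \<beta> - 2"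
  shows "coef_last \<beta> k > 0"
  unfolding coef_last_def
\<comment> \<open>The witness is not the empty head, whose lag is 0 and whose term vanishes for
  \<open>k \<ge> 1\<close>.\<close>
proof (rule infsum_pos[OF coef_last_summable[OF assms], of "[True]"])
  fix p assume "p \<in> heads"
  thus "0 \<le> real (fst (den p)) powr (- 2 * \<beta>) * hom_part \<beta> k (lag p) 0"
    using assms lag_bounds by (intro mult_nonneg_nonneg hom_part_nonneg) auto
next
  show "[True] \<in> heads" by (simp add: heads_def)
  have "lag [True] = 3/2" by (simp add: lag_def)
  thus "0 < real (fst (den [True])) powr (- 2 * \<beta>) * hom_part \<beta> k (lag [True]) 0"
    using assms negbin_pos[of \<beta> k] by (simp add: hom_part_zero_right)
qed

lemma coef_inner_pos:
  assumes "\<beta> > 1" "real k < \<beta> - 1"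
  shows "coef_inner \<beta> k > 0"
  unfolding coef_inner_def
\<comment> \<open>With both words empty \<open>lag_left\<close> would be 0, while
  \<open>hom_part_pos\<close> asks for two positive arguments.\<close>
proof (rule infsum_pos[OF coef_inner_summable[OF assms], of "([True], [])"])
  fix z :: "bool list \<times> bool list" assume "z \<in> heads \<times> UNIV"
  thus "0 \<le> (case z of (p, r) \<Rightarrow> inner_weight \<beta> p r * hom_part \<beta> k (lag_left p r) (lag_right p r))"
    using assms lag_inner_bounds by (auto intro!: mult_nonneg_nonneg hom_part_nonneg inner_weight_nonneg)
next
  show "([True], []) \<in> heads \<times> UNIV" by (simp add: heads_def)
  have "lag_left [True] [] = 3/2" "lag_right [True] [] = 5/2" by (simp_all add: lag_left_def lag_right_def lag_def)
  thus "0 < (case ([True], []) of (p, r) \<Rightarrow> inner_weight \<beta> p r * hom_part \<beta> k (lag_left p r) (lag_right p r))"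
    using assms by (simp add: inner_weight_def area_def hom_part_pos)
qed

lemma zeta_has_sum:
  assumes "s > 1"
  shows "((\<lambda>m. 1 / real (Suc m) powr s) has_sum zeta s) UNIV"
proof -
  have "summable (\<lambda>m. real (Suc m) powr - s)"
    using summable_real_powr_iff[of "- s"] assms by (subst summable_Suc_iff) simp
  hence "(\<lambda>m. 1 / real (Suc m) powr s) sums zeta s"
    unfolding zeta_def by (intro summable_sums) (simp add: powr_minus_divide)
  thus ?thesis by (rule sums_nonneg_imp_has_sum) auto
qed

lemma zeta_pos: "s > 1 \<Longrightarrow> zeta s > 0"
  using has_sum_strict_mono[OF has_sum_0_simp zeta_has_sum[of s], of 0] by simp

text \<open>A pair \<open>v \<le> u\<close> is in a unique way its gcd times a coprime pair. The
  first coordinate is stored minus one, to fit the indexing of \<open>zeta\<close>.\<close>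

lemma bij_betw_scaled_heads:
  "bij_betw (\<lambda>(m, p). (Suc m * fst (den p) - 1, Suc m * snd (den p))) (UNIV \<times> heads)
     (SIGMA m:UNIV. {1..Suc m})" (is "bij_betw ?f ?A ?B")
proof (rule bij_betw_imageI)
  show "inj_on ?f ?A"
  proof (rule inj_onI)
    fix x y assume xy: "x \<in> ?A" "y \<in> ?A" "?f x = ?f y"
    obtain m p m' p' where d: "x = (m, p)" "y = (m', p')" by fastforce
    have pos: "Suc m * fst (den p) > 0" "Suc m' * fst (den p') > 0" using den_pos by simp_all
    have "Suc m * fst (den p) - 1 = Suc m' * fst (den p') - 1" and 2: "Suc m * snd (den p) = Suc m' * snd (den p')"
      using xy(3) unfolding d by (simp_all only: case_prod_conv prod.inject)
    hence 1: "Suc m * fst (den p) = Suc m' * fst (den p')" using pos by linarith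
    have "gcd (Suc m * fst (den p)) (Suc m * snd (den p)) = Suc m"
      for m p using coprime_den[of p] by (simp only: gcd_mult_distrib_nat[symmetric] coprime_imp_gcd_eq_1 mult_1_right)
    from this[of m p] this[of m' p'] have "Suc m = Suc m'" unfolding 1 2 by linarith
    moreover from this have "den p = den p'" using 1 2 by (simp add: prod_eq_iff del: mult_Suc)
    ultimately show "x = y" using inj_den by (simp add: d inj_eq)
  qed
  show "?f ` ?A = ?B"
  proof (intro equalityI subsetI)
    fix z assume "z \<in> ?f ` ?A"
    then obtain m p where z: "z = ?f (m, p)" "p \<in> heads" by auto
    have "Suc m * snd (den p) \<le> Suc m * fst (den p)" "Suc m * snd (den p) > 0"
      using heads_den_le[OF z(2)] den_pos[of p] by (simp_all only: mult_le_mono2 nat_0_less_mult_iff zero_less_Suc)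
    thus "z \<in> ?B" unfolding z by (simp del: mult_Suc)
  next
    fix z assume "z \<in> ?B"
    then obtain m v where z: "z = (m, v)" "1 \<le> v" "v \<le> Suc m" by auto
    define d where "d = gcd (Suc m) v"
    have d: "d > 0" by (simp add: d_def)
    obtain u' v' where uv: "Suc m = d * u'" "v = d * v'" unfolding d_def
      by (meson dvdE gcd_dvd1 gcd_dvd2)
    have "d * gcd u' v' = d" unfolding gcd_mult_distrib_nat uv[symmetric] by (rule d_def[symmetric])
    hence "coprime u' v'" using d by (simp add: coprime_iff_gcd_eq_1)
    moreover have "1 \<le> v'" using z uv by (cases v') auto
    moreover have "v' \<le> u'" using z(3) d unfolding uv by simp
    ultimately have "(u', v') \<in> den ` heads" by (simp add: den_image_heads)
    then obtain p where p: "p \<in> heads" "den p = (u', v')" by auto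
    have "Suc (d - 1) = d" using d by simp
    hence "?f (d - 1, p) = z" unfolding z(1) case_prod_conv p(2) fst_conv snd_conv uv(2)
      using uv(1) by simp
    thus "z \<in> ?f ` ?A" using p by blast
  qed
qed

text \<open>Multiplying the sum of \<open>u powr (- 2 * \<beta>)\<close> over coprime pairs by
  \<open>zeta (2 * \<beta>)\<close> gives the sum over all pairs \<open>v \<le> u\<close>; each
  \<open>u\<close> now occurs \<open>u\<close> times, which yields
  \<open>zeta (2 * \<beta> - 1)\<close>.\<close>

lemma coef_last_0:
  assumes "\<beta> > 1"
  shows "coef_last \<beta> 0 = zeta (2 * \<beta> - 1) / zeta (2 * \<beta>)"
proof -
  let ?h = "\<lambda>p. real (fst (den p)) powr (- 2 * \<beta>)"
  let ?f = "\<lambda>(m, p). (Suc m * fst (den p) - 1, Suc m * snd (den p))"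
  let ?g = "\<lambda>(m :: nat, v :: nat). 1 / real (Suc m) powr (2 * \<beta>)"
  have hs: "?h summable_on heads" using heads_powr_summable[of "2 * \<beta>"] assms by simp
  have zs: "((\<lambda>m. 1 / real (Suc m) powr (2 * \<beta>)) has_sum zeta (2 * \<beta>)) UNIV"
    using assms by (intro zeta_has_sum) auto
  have sm: "(\<lambda>(m, p). 1 / real (Suc m) powr (2 * \<beta>) * ?h p) summable_on UNIV \<times> heads"
    using has_sum_imp_summable[OF zs] hs by (intro summable_on_times) auto
  have g: "?g (?f z) = (\<lambda>(m, p). 1 / real (Suc m) powr (2 * \<beta>) * ?h p) z" for z
  proof -
    obtain m p where z: "z = (m, p)" by fastforce
    have "Suc (Suc m * fst (den p) - 1) = Suc m * fst (den p)" using den_pos[of p] by simp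
    thus ?thesis unfolding z
      by (simp only: case_prod_conv of_nat_mult powr_mult) (simp add: powr_minus_divide)
  qed
  have sB: "?g summable_on (SIGMA m:UNIV. {1..Suc m})"
    using summable_on_reindex_bij_betw[OF bij_betw_scaled_heads, of ?g] sm unfolding g by simp
  have "zeta (2 * \<beta>) * coef_last \<beta> 0 = infsum (\<lambda>m. infsum (\<lambda>p. 1 / real (Suc m) powr (2 * \<beta>) * ?h p) heads) UNIV"
    unfolding infsum_cmult_right' infsum_cmult_left' infsumI[OF zs] by (simp add: coef_last_def)
  also have "\<dots> = infsum (\<lambda>(m, p). 1 / real (Suc m) powr (2 * \<beta>) * ?h p) (UNIV \<times> heads)"
    by (rule infsum_Sigma'_banach[OF sm])
  also have "\<dots> = infsum ?g (SIGMA m:UNIV. {1..Suc m})"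
    using infsum_reindex_bij_betw[OF bij_betw_scaled_heads, of ?g] unfolding g by simp
  also have "\<dots> = infsum (\<lambda>m. infsum (\<lambda>v. 1 / real (Suc m) powr (2 * \<beta>)) {1..Suc m}) UNIV"
    by (rule infsum_Sigma'_banach[OF sB, symmetric])
  also have "\<dots> = infsum (\<lambda>m. 1 / real (Suc m) powr (2 * \<beta> - 1)) UNIV"
    by (intro infsum_cong) (simp add: powr_diff)
  also have "\<dots> = zeta (2 * \<beta> - 1)" using assms by (intro infsumI zeta_has_sum) auto
  finally show ?thesis using zeta_pos[of "2 * \<beta>"] assms by (simp add: field_simps)
qed

section \<open>Words without a dominating block\<close>

definition last_word :: "nat \<Rightarrow> bool list \<Rightarrow> bool list" where
  "last_word n p = replicate (n - Suc (length p)) False @ p"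

definition inner_word :: "nat \<Rightarrow> bool list \<times> bool list \<Rightarrow> bool list" where
  "inner_word n = (\<lambda>(p, r). r @ True # replicate (n - (length p + length r + 2)) False @ p)"

lemma heads_iff: "p \<in> heads \<longleftrightarrow> p = [] \<or> hd p \<noteq> False"
  by (auto simp: heads_def)

lemma sum_area_map_Not:
  "(\<Sum>w\<in>map Not ` B. area w powr - \<beta>) = (\<Sum>w\<in>B. area w powr - \<beta>)"
proof -
  have "inj (map Not)" by (intro inj_mapI injI) simp
  hence "(\<Sum>w\<in>map Not ` B. area w powr - \<beta>) = (\<Sum>w\<in>B. area (map Not w) powr - \<beta>)"
    by (subst sum.reindex) (auto intro: inj_on_subset)
  thus ?thesis by (simp add: area_map_Not)
qed

text \<open>In \<open>F1\<close> and \<open>F2\<close> the block is longer than the rest of the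
  word, so by \<open>long_block_unique\<close> the word determines its block. Hence the four
  families, two of them complements, are disjoint and injectively parametrized.\<close>

lemma sum_long_blocks:
  fixes n :: nat and \<beta> :: real
  defines "F1 \<equiv> {p \<in> heads. 2 * Suc (length p) \<le> n}"
    and "F2 \<equiv> {(p, r). p \<in> heads \<and> 2 * (length p + length r + 2) \<le> n}"
  defines "B \<equiv> last_word n ` F1 \<union> inner_word n ` F2"
  shows "finite B" "B \<union> map Not ` B \<subseteq> {w. length w = n - 1}"
    "(\<Sum>w\<in>B \<union> map Not ` B. area w powr - \<beta>) =
      2 * ((\<Sum>p\<in>F1. area (last_word n p) powr - \<beta>) + (\<Sum>z\<in>F2. area (inner_word n z) powr - \<beta>))"
proof -
  have "F1 \<subseteq> {p. length p \<le> n}" "F2 \<subseteq> {p. length p \<le> n} \<times> {p. length p \<le> n}"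
    by (auto simp: F1_def F2_def)
  hence fin: "finite F1" "finite F2"
    by (auto intro: finite_subset[OF _ finite_short_words] finite_subset[OF _ finite_cartesian_product[OF finite_short_words finite_short_words]])
  thus fB: "finite B" by (simp add: B_def)
  show "B \<union> map Not ` B \<subseteq> {w. length w = n - 1}"
    by (auto simp: B_def F1_def F2_def last_word_def inner_word_def)
  \<comment> \<open>Both words are put in the shape of \<open>long_block_unique\<close>; in the
    second one \<open>True\<close> belongs to the outer part, which thus does not end in
    \<open>False\<close>.\<close>
  have last: "last_word n p = [] @ replicate (n - Suc (length p)) False @ p" for p
    by (simp add: last_word_def)
  have inner: "inner_word n (p, r) = (r @ [True]) @ replicate (n - (length p + length r + 2)) False @ p" for p r
    by (simp add: inner_word_def)
  have inj1: "inj_on (last_word n) F1"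
  proof (rule inj_onI)
    fix p p' assume p: "p \<in> F1" "p' \<in> F1" "last_word n p = last_word n p'"
    have "[] = ([] :: bool list) \<and> False = False \<and> p = p' \<and> n - Suc (length p) = n - Suc (length p')"
      by (rule long_block_unique[OF p(3)[unfolded last]]) (use p in \<open>auto simp: F1_def heads_iff\<close>)
    thus "p = p'" by simp
  qed
  have inj2: "inj_on (inner_word n) F2"
  proof (rule inj_onI)
    fix z z' assume z: "z \<in> F2" "z' \<in> F2" "inner_word n z = inner_word n z'"
    obtain p r p' r' where d: "z = (p, r)" "z' = (p', r')" by fastforce
    have "r @ [True] = r' @ [True] \<and> False = False \<and> p = p' \<and>
        n - (length p + length r + 2) = n - (length p' + length r' + 2)"
      by (rule long_block_unique[OF z(3)[unfolded d inner]]) (use z in \<open>auto simp: d F2_def heads_iff\<close>)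
    thus "z = z'" by (simp add: d)
  qed
  have disj: "last_word n ` F1 \<inter> inner_word n ` F2 = {}"
  proof (rule ccontr)
    assume "\<not> ?thesis"
    then obtain p y where py: "p \<in> F1" "y \<in> F2" "last_word n p = inner_word n y" by blast
    obtain p' r' where "y = (p', r')" by fastforce
    with py have z: "p \<in> F1" "(p', r') \<in> F2" "last_word n p = inner_word n (p', r')" by simp_all
    have "[] = r' @ [True] \<and> False = False \<and> p = p' \<and>
        n - Suc (length p) = n - (length p' + length r' + 2)"
      by (rule long_block_unique[OF z(3)[unfolded last inner]]) (use z in \<open>auto simp: F1_def F2_def heads_iff\<close>)
    thus False by simp
  qed
  have block: "\<exists>r a p. w = r @ replicate a False @ p \<and> (p = [] \<or> hd p \<noteq> False) \<and> (r = [] \<or> last r \<noteq> False)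
      \<and> length r + length p < a" if "w \<in> B" for w
    using that unfolding B_def
  proof
    assume "w \<in> last_word n ` F1"
    then obtain p where "p \<in> F1" "w = last_word n p" by blast
    thus ?thesis unfolding last
      by (intro exI[of _ "[]"] exI[of _ "n - Suc (length p)"] exI[of _ p]) (auto simp: F1_def heads_iff)
  next
    assume "w \<in> inner_word n ` F2"
    then obtain p r where "(p, r) \<in> F2" "w = inner_word n (p, r)" by auto
    thus ?thesis unfolding inner
      by (intro exI[of _ "r @ [True]"] exI[of _ "n - (length p + length r + 2)"] exI[of _ p])
        (auto simp: F2_def heads_iff)
  qed
  \<comment> \<open>A common word would have dominating blocks of opposite letters.\<close>
  have disj2: "B \<inter> map Not ` B = {}"
  proof (rule ccontr)
    assume "\<not> ?thesis"
    then obtain w w' where w: "w \<in> B" "w' \<in> B" "w = map Not w'" by blast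
    obtain r a p where 1: "w = r @ replicate a False @ p" "p = [] \<or> hd p \<noteq> False" "r = [] \<or> last r \<noteq> False"
      "length r + length p < a" using block[OF w(1)] by blast
    obtain r' a' p' where 2: "w' = r' @ replicate a' False @ p'" "p' = [] \<or> hd p' \<noteq> False" "r' = [] \<or> last r' \<noteq> False"
      "length r' + length p' < a'" using block[OF w(2)] by blast
    have "r @ replicate a False @ p = map Not r' @ replicate a' True @ map Not p'" using w(3) 1(1) 2(1) by simp
    hence "r = map Not r' \<and> False = True \<and> p = map Not p' \<and> a = a'"
      by (rule long_block_unique) (use 1 2 in \<open>auto simp: hd_map last_map\<close>)
    thus False by simp
  qed
  have "(\<Sum>w\<in>B \<union> map Not ` B. area w powr - \<beta>) = (\<Sum>w\<in>B. area w powr - \<beta>) + (\<Sum>w\<in>map Not ` B. area w powr - \<beta>)"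
    using fB disj2 by (intro sum.union_disjoint) auto
  also have "\<dots> = 2 * (\<Sum>w\<in>B. area w powr - \<beta>)" by (simp add: sum_area_map_Not)
  also have "(\<Sum>w\<in>B. area w powr - \<beta>) = (\<Sum>w\<in>last_word n ` F1. area w powr - \<beta>) + (\<Sum>w\<in>inner_word n ` F2. area w powr - \<beta>)"
    unfolding B_def using fin disj by (intro sum.union_disjoint) auto
  also have "\<dots> = (\<Sum>p\<in>F1. area (last_word n p) powr - \<beta>) + (\<Sum>z\<in>F2. area (inner_word n z) powr - \<beta>)"
    using inj1 inj2 by (simp add: sum.reindex)
  finally show "(\<Sum>w\<in>B \<union> map Not ` B. area w powr - \<beta>) =
      2 * ((\<Sum>p\<in>F1. area (last_word n p) powr - \<beta>) + (\<Sum>z\<in>F2. area (inner_word n z) powr - \<beta>))" .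
qed

lemma block_cases:
  assumes w: "w = r @ replicate a b @ p" "p = [] \<or> hd p \<noteq> b" "r = [] \<or> last r \<noteq> b" "length w = n - 1" "n \<ge> 1"
  obtains (last) q where "q \<in> heads" "a + Suc (length q) = n" "w = last_word n q \<or> w = map Not (last_word n q)"
  | (inner) q s where "q \<in> heads" "a + (length q + length s + 2) = n"
      "w = inner_word n (q, s) \<or> w = map Not (inner_word n (q, s))"
proof -
  \<comment> \<open>An involution that turns the block into one of \<open>False\<close>.\<close>
  define f where "f = (if b then map Not else (\<lambda>x. x))"
  have ff: "f (f x) = x" for x by (simp add: f_def o_def)
  have fw: "f w = f r @ replicate a False @ f p" by (simp add: w(1) f_def)
  have w': "w = f (f w)" by (simp add: ff)
  have len: "length (f x) = length x" for x by (simp add: f_def)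
  have q: "f p \<in> heads" using w(2) by (cases b; cases p) (simp_all add: heads_def f_def)
  have n: "length r + a + length p = n - 1" using w(1,4) by simp
  show thesis
  proof (cases "r = []")
    case True
    have "f w = last_word n (f p)" using fw True n w(5) by (simp add: last_word_def len f_def)
    hence "w = last_word n (f p) \<or> w = map Not (last_word n (f p))"
      using w' by (metis f_def)
    thus ?thesis using q n True w(5) by (intro last[of "f p"]) (auto simp: len)
  next
    case False
    define s where "s = butlast (f r)"
    have fr: "f r \<noteq> []" "last (f r)"
      using False w(3) by (cases b; simp add: f_def last_map)+
    hence s: "f r = s @ [True]" unfolding s_def by (metis append_butlast_last_id)
    hence ls: "length r = Suc (length s)" using len[of r] by simp
    have a: "a + (length (f p) + length s + 2) = n" using n w(5) ls by (simp add: len)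
    hence "n - (length (f p) + length s + 2) = a" by linarith
    hence "f w = inner_word n (f p, s)" using fw s by (simp add: inner_word_def)
    hence "w = inner_word n (f p, s) \<or> w = map Not (inner_word n (f p, s))"
      using w' by (metis f_def)
    thus ?thesis using q a by (intro inner[of "f p" s])
  qed
qed

lemma area_last_word_ge:
  assumes "p \<in> heads" "A \<le> real (n - Suc (length p))" "A > 0" "\<beta> > 0"
  shows "area (last_word n p) powr - \<beta> \<le> A powr - \<beta> * real (fst (den p)) powr (- 2 * \<beta>)"
proof -
  have u: "real (fst (den p)) > 0" using den_pos by simp
  have "real (fst (den p)) * (A * real (fst (den p))) \<le>
      real (fst (den p)) * (real (snd (den p)) + real (n - Suc (length p)) * real (fst (den p)))"
    using assms u by (intro mult_left_mono add_increasing mult_right_mono) auto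
  hence "A * (real (fst (den p)) * real (fst (den p))) \<le> area (last_word n p)"
    unfolding last_word_def area_block_last by (simp only: mult_ac)
  hence "area (last_word n p) powr - \<beta> \<le> (A * (real (fst (den p)) * real (fst (den p)))) powr - \<beta>"
    using u assms by (intro powr_mono2') auto
  also have "\<dots> = A powr - \<beta> * real (fst (den p)) powr (- 2 * \<beta>)"
    using u assms by (simp add: powr_mult flip: powr_add)
  finally show ?thesis .
qed

lemma area_inner_word_ge:
  assumes "p \<in> heads" "A \<le> real (n - (length p + length r + 2))" "A > 0" "\<beta> > 0"
  shows "area (inner_word n (p, r)) powr - \<beta> \<le> A powr (- 2 * \<beta>) * inner_weight \<beta> p r"
proof -
  let ?u = "real (fst (den p))" and ?c = "real (fst (den r))" and ?d = "real (snd (den r))"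
  let ?a = "real (n - (length p + length r + 2))"
  have pos: "?u > 0" "?c > 0" "?d > 0" using den_pos by simp_all
  have Y: "A * ?u \<le> real (snd (den p)) + ?a * ?u"
    using assms pos by (intro add_increasing mult_right_mono) auto
  have X: "c * (A * ?u) \<le> c * (real (snd (den p)) + ?a * ?u) + x * ?u" if "c > 0" "x \<ge> 0" for c x
  proof -
    have "c * (A * ?u) \<le> c * (real (snd (den p)) + ?a * ?u)" using Y that by (intro mult_left_mono) auto
    moreover have "0 \<le> x * ?u" using that pos by simp
    ultimately show ?thesis by linarith
  qed
  have "(?c * (A * ?u)) * (?d * (A * ?u)) \<le> area (inner_word n (p, r))"
    unfolding inner_word_def case_prod_conv area_block_inner
    by (intro mult_mono X) (use pos assms in auto)
  also have "(?c * (A * ?u)) * (?d * (A * ?u)) = (A * A) * ((?u * ?u) * (?c * ?d))" by (simp only: mult_ac)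
  finally have "area (inner_word n (p, r)) powr - \<beta> \<le> ((A * A) * ((?u * ?u) * (?c * ?d))) powr - \<beta>"
    using pos assms by (intro powr_mono2') auto
  also have "\<dots> = A powr (- 2 * \<beta>) * inner_weight \<beta> p r"
    using pos assms by (simp add: powr_mult inner_weight_def area_def flip: powr_add)
  finally show ?thesis .
qed

text \<open>A block of length at least \<open>A\<close> gives area at least
  \<open>A u\<^sup>2\<close>, and for a head this long \<open>head_err\<close> is at least
  \<open>u powr (- 2 * \<beta>)\<close>.\<close>

lemma sum_last_word_long_heads:
  assumes \<beta>: "\<beta> > 1" and K: "K \<ge> 1" "2 * \<beta> - 2 \<le> real K" "real K < 2 * \<beta> - 1" and n: "n \<ge> 1" and A: "A > 0"
  defines "B \<equiv> (2 ^ K + 2 ^ K * (2 * \<beta> - K) / (2 * \<beta> - K - 1) * 2 powr (2 * \<beta>)) * (real n powr (2 - 2 * \<beta>) * (1 + ln (real n)))"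
    and "G \<equiv> {p \<in> heads. A \<le> real (n - Suc (length p)) \<and> n < 2 * Suc (length p)}"
  shows "finite G" "(\<Sum>p\<in>G. area (last_word n p) powr - \<beta>) \<le> A powr - \<beta> * B"
proof -
  have "G \<subseteq> {p. length p \<le> n}" using A by (auto simp: G_def)
  thus fG: "finite G" by (rule finite_subset) simp
  note hs = heads_summable[of "head_err \<beta> K n", OF head_err_nonneg head_err_sum_le[OF \<beta> K n, folded B_def]]
  have "(\<Sum>p\<in>G. area (last_word n p) powr - \<beta>) \<le> (\<Sum>p\<in>G. A powr - \<beta> * head_err \<beta> K n (fst (den p)))"
  proof (rule sum_mono)
    fix p assume p: "p \<in> G"
    let ?z = "2 * (real (Suc (length p)) / real n)"
    have "real n \<le> real (2 * Suc (length p))" using p unfolding G_def by (intro of_nat_mono) auto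
    hence "1 \<le> ?z" using n by (simp add: field_simps)
    hence "1 \<le> ?z ^ (K - 1)" by (rule one_le_power)
    hence "real (fst (den p)) powr (- 2 * \<beta>) * 1 \<le> real (fst (den p)) powr (- 2 * \<beta>) * ?z ^ (K - 1)"
      by (intro mult_left_mono) auto
    also have "\<dots> \<le> head_err \<beta> K n (fst (den p))"
      using head_err_ge[of p n K \<beta>] p n K by (simp add: G_def)
    finally have "A powr - \<beta> * real (fst (den p)) powr (- 2 * \<beta>) \<le> A powr - \<beta> * head_err \<beta> K n (fst (den p))"
      by (intro mult_left_mono) auto
    moreover have "area (last_word n p) powr - \<beta> \<le> A powr - \<beta> * real (fst (den p)) powr (- 2 * \<beta>)"
      using p \<beta> A by (intro area_last_word_ge) (auto simp: G_def)
    ultimately show "area (last_word n p) powr - \<beta> \<le> A powr - \<beta> * head_err \<beta> K n (fst (den p))" by linarith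
  qed
  also have "\<dots> = A powr - \<beta> * (\<Sum>p\<in>G. head_err \<beta> K n (fst (den p)))" by (simp add: sum_distrib_left)
  also have "(\<Sum>p\<in>G. head_err \<beta> K n (fst (den p))) \<le> infsum (\<lambda>p. head_err \<beta> K n (fst (den p))) heads"
    by (rule finite_sum_le_infsum[OF hs(1) fG]) (auto simp: G_def head_err_nonneg)
  also have "\<dots> \<le> B" by (rule hs(2))
  finally show "(\<Sum>p\<in>G. area (last_word n p) powr - \<beta>) \<le> A powr - \<beta> * B"
    by (simp add: mult_left_mono)
qed

text \<open>As in Markov's inequality, a factor \<open>(2 L / n) ^ K \<ge> 1\<close> is inserted,
  where \<open>L = length p + length r + 2\<close> exceeds \<open>n/2\<close>.\<close>

lemma sum_inner_word_long_ends:
  assumes \<beta>: "\<beta> > 1" and K: "real K < \<beta> - 1" and n: "n \<ge> 1" and A: "A > 0"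
  defines "G \<equiv> {(p, r). p \<in> heads \<and> A \<le> real (n - (length p + length r + 2)) \<and> n < 2 * (length p + length r + 2)}"
  shows "finite G" "(\<Sum>z\<in>G. area (inner_word n z) powr - \<beta>) \<le> A powr (- 2 * \<beta>) * (2 / real n) ^ K * inner_moment \<beta> K"
proof -
  have "G \<subseteq> {p. length p \<le> n} \<times> {p. length p \<le> n}" using A by (auto simp: G_def)
  thus fG: "finite G" by (rule finite_subset) simp
  let ?M = "\<lambda>(p, r). inner_weight \<beta> p r * real (length p + length r + 2) ^ K"
  have "(\<Sum>z\<in>G. area (inner_word n z) powr - \<beta>) \<le> (\<Sum>z\<in>G. A powr (- 2 * \<beta>) * (2 / real n) ^ K * ?M z)"
  proof (rule sum_mono)
    fix z assume z: "z \<in> G"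
    obtain p r where d: "z = (p, r)" by fastforce
    define L where "L = real (length p + length r + 2)"
    have "real n \<le> real (2 * (length p + length r + 2))" using z unfolding G_def d by (intro of_nat_mono) auto
    hence "1 \<le> 2 / real n * L" unfolding L_def using n by (simp add: field_simps)
    hence "1 \<le> (2 / real n * L) ^ K" by (rule one_le_power)
    hence "A powr (- 2 * \<beta>) * inner_weight \<beta> p r * 1 \<le> A powr (- 2 * \<beta>) * inner_weight \<beta> p r * (2 / real n * L) ^ K"
      by (intro mult_left_mono mult_nonneg_nonneg inner_weight_nonneg) auto
    moreover have "area (inner_word n z) powr - \<beta> \<le> A powr (- 2 * \<beta>) * inner_weight \<beta> p r"
      unfolding d using z \<beta> A by (intro area_inner_word_ge) (auto simp: G_def d)
    ultimately have "area (inner_word n z) powr - \<beta> \<le> A powr (- 2 * \<beta>) * inner_weight \<beta> p r * (2 / real n * L) ^ K"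
      by linarith
    thus "area (inner_word n z) powr - \<beta> \<le> A powr (- 2 * \<beta>) * (2 / real n) ^ K * ?M z"
      unfolding d case_prod_conv L_def power_mult_distrib by (simp only: mult_ac)
  qed
  also have "\<dots> = A powr (- 2 * \<beta>) * (2 / real n) ^ K * (\<Sum>z\<in>G. ?M z)" by (simp add: sum_distrib_left)
  also have "\<dots> \<le> A powr (- 2 * \<beta>) * (2 / real n) ^ K * inner_moment \<beta> K"
    unfolding inner_moment_def
    by (intro mult_left_mono finite_sum_le_infsum[OF inner_moment_summable[OF \<beta> K] fG])
      (auto simp: G_def inner_weight_nonneg)
  finally show "(\<Sum>z\<in>G. area (inner_word n z) powr - \<beta>) \<le> A powr (- 2 * \<beta>) * (2 / real n) ^ K * inner_moment \<beta> K" .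
qed

text \<open>Of the exponent \<open>\<beta>\<close>, the part \<open>\<beta> - 1\<close> is spent on
  the bound by changes; the remaining \<open>1 / area w\<close> sums to at most 1.\<close>

lemma sum_many_changes:
  assumes "\<beta> > 1" "\<And>w. w \<in> S \<Longrightarrow> length w = n" "\<And>w. w \<in> S \<Longrightarrow> c \<le> real (changes w)"
  shows "(\<Sum>w\<in>S. area w powr - \<beta>) \<le> 2 powr - (c * (\<beta> - 1))"
proof -
  have S: "S \<subseteq> {w. length w = n}" using assms(2) by auto
  have "(\<Sum>w\<in>S. area w powr - \<beta>) \<le> (\<Sum>w\<in>S. 2 powr - (c * (\<beta> - 1)) * (1 / area w))"
  proof (rule sum_mono)
    fix w assume w: "w \<in> S"
    have "2 powr c \<le> 2 powr real (changes w)" using assms(3)[OF w] by simp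
    also have "\<dots> \<le> area w" using area_ge_changes[of w] by (simp add: powr_realpow)
    finally have "area w powr - (\<beta> - 1) \<le> (2 powr c) powr - (\<beta> - 1)"
      using assms(1) by (intro powr_mono2') auto
    hence "area w powr - (\<beta> - 1) * (1 / area w) \<le> 2 powr - (c * (\<beta> - 1)) * (1 / area w)"
      using area_pos[of w] by (intro mult_right_mono) (auto simp: powr_powr algebra_simps)
    moreover have "area w powr - \<beta> = area w powr - (\<beta> - 1) * (1 / area w)"
      using area_pos[of w] by (simp add: powr_diff powr_minus field_simps)
    ultimately show "area w powr - \<beta> \<le> 2 powr - (c * (\<beta> - 1)) * (1 / area w)" by linarith
  qed
  also have "\<dots> = 2 powr - (c * (\<beta> - 1)) * (\<Sum>w\<in>S. 1 / area w)" by (simp add: sum_distrib_left)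
  also have "(\<Sum>w\<in>S. 1 / area w) \<le> (\<Sum>w | length w = n. 1 / area w)"
    using S area_pos by (intro sum_mono2) (auto simp: less_imp_le)
  also have "\<dots> = 1" by (rule sum_inverse_area)
  finally show ?thesis by (simp add: mult_left_mono)
qed

lemma sum_Un_le_add:
  fixes f :: "'a \<Rightarrow> real"
  assumes "finite A" "finite B" "\<And>x. 0 \<le> f x"
  shows "sum f (A \<union> B) \<le> sum f A + sum f B"
  using sum.union_inter[OF assms(1,2), of f] sum_nonneg[of "A \<inter> B" f] assms(3) by simp

text \<open>A remaining word either has a block of length at least \<open>A\<close> with long outer
  parts, or \<open>n - 1 \<le> A (changes w + 1)\<close>, which explains the exponent of 2.\<close>

lemma sum_short_blocks:
  fixes n K1 K2 :: nat and \<beta> A :: real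
  assumes \<beta>: "\<beta> > 1" and K1: "K1 \<ge> 1" "2 * \<beta> - 2 \<le> real K1" "real K1 < 2 * \<beta> - 1"
    and K2: "real K2 < \<beta> - 1" and n: "n \<ge> 1" and A: "A > 0"
  defines "F1 \<equiv> {p \<in> heads. 2 * Suc (length p) \<le> n}"
    and "F2 \<equiv> {(p, r). p \<in> heads \<and> 2 * (length p + length r + 2) \<le> n}"
  defines "B \<equiv> last_word n ` F1 \<union> inner_word n ` F2"
  defines "c1 \<equiv> 2 ^ K1 + 2 ^ K1 * (2 * \<beta> - K1) / (2 * \<beta> - K1 - 1) * 2 powr (2 * \<beta>)"
  shows "(\<Sum>w\<in>{w. length w = n - 1} - (B \<union> map Not ` B). area w powr - \<beta>) \<le>
    2 powr - ((real (n - 1) / A - 1) * (\<beta> - 1)) +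
    2 * (A powr - \<beta> * (c1 * (real n powr (2 - 2 * \<beta>) * (1 + ln (real n)))) +
         A powr (- 2 * \<beta>) * (2 / real n) ^ K2 * inner_moment \<beta> K2)"
proof -
  let ?f = "\<lambda>w. area w powr - \<beta>"
  define G1 where "G1 = {p \<in> heads. A \<le> real (n - Suc (length p)) \<and> n < 2 * Suc (length p)}"
  define G2 :: "(bool list \<times> bool list) set"
    where "G2 = {(p, r). p \<in> heads \<and> A \<le> real (n - (length p + length r + 2)) \<and> n < 2 * (length p + length r + 2)}"
  define X where "X = last_word n ` G1 \<union> inner_word n ` G2"
  define S where "S = {w. length w = n - 1 \<and> real (n - 1) / A - 1 \<le> real (changes w)}"
  note G1 = sum_last_word_long_heads[OF \<beta> K1 n A, folded G1_def c1_def]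
  note G2 = sum_inner_word_long_ends[OF \<beta> K2 n A, folded G2_def]
  have fS: "finite S" by (rule finite_subset[OF _ finite_words[of "n - 1"]]) (auto simp: S_def)
  have fX: "finite X" using G1(1) G2(1) by (simp add: X_def)
  have "{w. length w = n - 1} - (B \<union> map Not ` B) \<subseteq> S \<union> (X \<union> map Not ` X)"
  proof
    fix w assume "w \<in> {w. length w = n - 1} - (B \<union> map Not ` B)"
    hence len: "length w = n - 1" and nB: "w \<notin> B" "w \<notin> map Not ` B" by auto
    consider (block) r a b p where "w = r @ replicate a b @ p" "p = [] \<or> hd p \<noteq> b" "r = [] \<or> last r \<noteq> b" "A \<le> real a"
      | (many) "real (length w) \<le> A * (real (changes w) + 1)"
      using long_block_or_many_changes[OF A, of w] by blast
    thus "w \<in> S \<union> (X \<union> map Not ` X)"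
    proof cases
      case many
      hence "w \<in> S" using A len by (simp add: S_def field_simps)
      thus ?thesis by blast
    next
      case block
      from block(1-3) len n show ?thesis
      proof (cases rule: block_cases)
        case (last q)
        have "\<not> 2 * Suc (length q) \<le> n" using last nB by (auto simp: B_def F1_def)
        moreover have "n - Suc (length q) = a" using last(2) by linarith
        ultimately have "q \<in> G1" using last block(4) by (simp add: G1_def)
        thus ?thesis using last(3) by (auto simp: X_def)
      next
        case (inner q s)
        have "\<not> 2 * (length q + length s + 2) \<le> n" using inner nB by (auto simp: B_def F2_def)
        moreover have "n - (length q + length s + 2) = a" using inner(2) by linarith
        ultimately have "(q, s) \<in> G2" using inner block(4) by (simp add: G2_def)
        hence "inner_word n (q, s) \<in> X" unfolding X_def by blast
        thus ?thesis using inner(3) by blast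
      qed
    qed
  qed
  hence "(\<Sum>w\<in>{w. length w = n - 1} - (B \<union> map Not ` B). ?f w) \<le> sum ?f (S \<union> (X \<union> map Not ` X))"
    using fS fX by (intro sum_mono2) auto
  also have "\<dots> \<le> sum ?f S + sum ?f (X \<union> map Not ` X)"
    using fS fX by (intro sum_Un_le_add) auto
  also have "sum ?f (X \<union> map Not ` X) \<le> sum ?f X + sum ?f (map Not ` X)"
    using fX by (intro sum_Un_le_add) auto
  also have "\<dots> = 2 * sum ?f X" by (simp add: sum_area_map_Not)
  also have "sum ?f X \<le> sum ?f (last_word n ` G1) + sum ?f (inner_word n ` G2)"
    unfolding X_def using G1(1) G2(1) by (intro sum_Un_le_add) auto
  also have "sum ?f (last_word n ` G1) \<le> (\<Sum>p\<in>G1. ?f (last_word n p))"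
    using sum_image_le[OF G1(1), of ?f "last_word n"] by (simp add: o_def)
  also have "\<dots> \<le> A powr - \<beta> * (c1 * (real n powr (2 - 2 * \<beta>) * (1 + ln (real n))))"
    by (rule G1(2))
  \<comment> \<open>Blocks of length \<open>A\<close> need not dominate, so a word may be counted
    several times; this only enlarges the bound.\<close>
  also have "sum ?f (inner_word n ` G2) \<le> (\<Sum>z\<in>G2. ?f (inner_word n z))"
    using sum_image_le[OF G2(1), of ?f "inner_word n"] by (simp add: o_def)
  also have "\<dots> \<le> A powr (- 2 * \<beta>) * (2 / real n) ^ K2 * inner_moment \<beta> K2"
    by (rule G2(2))
  also have "sum ?f S \<le> 2 powr - ((real (n - 1) / A - 1) * (\<beta> - 1))"
    by (rule sum_many_changes[OF \<beta>, of _ "n - 1"]) (auto simp: S_def)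
  finally show ?thesis by simp
qed

text \<open>The error consists of the two expansion errors, the same quantities with
  \<open>A\<close> in place of \<open>n\<close> for the remaining block words, and the words with
  many changes. \<open>A\<close> is left free for a later choice.\<close>

lemma brocot_sigma_expansion:
  fixes n K1 K2 :: nat and \<beta> A :: real
  assumes \<beta>: "\<beta> > 1" and K1: "K1 \<ge> 1" "2 * \<beta> - 2 \<le> real K1" "real K1 < 2 * \<beta> - 1"
    and K2: "real K2 < \<beta> - 1" and n: "n \<ge> 1" and A: "A > 0"
  defines "c1 \<equiv> 2 ^ K1 + 2 ^ K1 * (2 * \<beta> - K1) / (2 * \<beta> - K1 - 1) * 2 powr (2 * \<beta>)"
  defines "b1 \<equiv> c1 * (real n powr (2 - 2 * \<beta>) * (1 + ln (real n)))"
    and "b2 \<equiv> (2 / real n) ^ K2 * inner_moment \<beta> K2"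
  shows "\<bar>brocot_sigma \<beta> n - 2 * ((\<Sum>k<K1. coef_last \<beta> k / real n powr (\<beta> + real k)) +
        (\<Sum>k<K2. coef_inner \<beta> k / real n powr (2 * \<beta> + real k)))\<bar> \<le>
    2 * 4 powr \<beta> * (real n powr - \<beta> * b1 + real n powr (- 2 * \<beta>) * b2) +
    2 * (A powr - \<beta> * b1 + A powr (- 2 * \<beta>) * b2) + 2 powr - ((real (n - 1) / A - 1) * (\<beta> - 1))"
proof -
  let ?f = "\<lambda>w. area w powr - \<beta>"
  define F1 where "F1 = {p \<in> heads. 2 * Suc (length p) \<le> n}"
  define F2 :: "(bool list \<times> bool list) set"
    where "F2 = {(p, r). p \<in> heads \<and> 2 * (length p + length r + 2) \<le> n}"
  define B where "B = last_word n ` F1 \<union> inner_word n ` F2"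
  define R where "R = (\<Sum>w\<in>{w. length w = n - 1} - (B \<union> map Not ` B). ?f w)"
  define S1 where "S1 = (\<Sum>p\<in>F1. ?f (last_word n p))"
  define S2 where "S2 = (\<Sum>z\<in>F2. ?f (inner_word n z))"
  define T1 where "T1 = (\<Sum>k<K1. coef_last \<beta> k / real n powr (\<beta> + real k))"
  define T2 where "T2 = (\<Sum>k<K2. coef_inner \<beta> k / real n powr (2 * \<beta> + real k))"
  note lb = sum_long_blocks(2)[of n, folded F1_def F2_def, folded B_def]
  note long_sum = sum_long_blocks(3)[where n = n and \<beta> = \<beta>, folded F1_def F2_def, folded B_def]
  have "brocot_sigma \<beta> n = (\<Sum>w | length w = n - 1. ?f w)"
    using brocot_sigma_eq_sum_words[of \<beta> "n - 1"] n by simp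
  also have "\<dots> = R + (\<Sum>w\<in>B \<union> map Not ` B. ?f w)"
    unfolding R_def by (rule sum.subset_diff[OF lb finite_words])
  also have "(\<Sum>w\<in>B \<union> map Not ` B. ?f w) = 2 * (S1 + S2)"
    unfolding S1_def S2_def by (rule long_sum)
  finally have sigma: "brocot_sigma \<beta> n = R + 2 * (S1 + S2)" .
  have R0: "0 \<le> R" unfolding R_def by (intro sum_nonneg) auto
  have R: "R \<le> 2 powr - ((real (n - 1) / A - 1) * (\<beta> - 1)) +
      2 * (A powr - \<beta> * b1 + A powr (- 2 * \<beta>) * b2)"
    using sum_short_blocks[OF \<beta> K1 K2 n A, folded F1_def F2_def c1_def, folded B_def, folded R_def]
    by (simp add: b1_def b2_def mult_ac)
  have ST1: "\<bar>S1 - T1\<bar> \<le> real n powr - \<beta> * 4 powr \<beta> * b1"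
    using block_last_expansion[OF \<beta> K1 n, folded F1_def c1_def]
    by (simp add: S1_def T1_def b1_def last_word_def)
  have ST2: "\<bar>S2 - T2\<bar> \<le> real n powr (- 2 * \<beta>) * 4 powr \<beta> * b2"
    using block_inner_expansion[OF \<beta> K2 n, folded F2_def]
    by (simp add: S2_def T2_def b2_def inner_word_def case_prod_unfold mult.assoc)
  have "\<bar>brocot_sigma \<beta> n - 2 * (T1 + T2)\<bar> \<le> 2 * \<bar>S1 - T1\<bar> + 2 * \<bar>S2 - T2\<bar> + R"
    unfolding sigma using R0 by (smt (verit))
  also have "\<dots> \<le> 2 * (real n powr - \<beta> * 4 powr \<beta> * b1) + 2 * (real n powr (- 2 * \<beta>) * 4 powr \<beta> * b2) +
      (2 powr - ((real (n - 1) / A - 1) * (\<beta> - 1)) + 2 * (A powr - \<beta> * b1 + A powr (- 2 * \<beta>) * b2))"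
    by (intro add_mono mult_left_mono ST1 ST2 R) auto
  finally show ?thesis unfolding T1_def T2_def by (simp add: distrib_left mult_ac)
qed

theorem theorem2:
  fixes \<beta> :: real
  assumes "\<beta> > 1"
  shows "\<exists>C C' :: nat \<Rightarrow> real.
    (\<forall>k. 1 \<le> k \<and> real k < 2 * \<beta> - 2 \<longrightarrow> C k > 0) \<and>
    (\<forall>k. real k < \<beta> - 2 \<longrightarrow> C' k > 0) \<and>
    (\<lambda>n. brocot_sigma \<beta> n -
        (1 / real n powr \<beta> * (2 * zeta (2 * \<beta> - 1) / zeta (2 * \<beta>))
         + (\<Sum>k | 1 \<le> k \<and> real k < 2 * \<beta> - 2. C k * (1 / real n powr (\<beta> + real k)))
         + (\<Sum>k | real k < \<beta> - 2. C' k * (1 / real n powr (2 * \<beta> + real k)))))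
      \<in> O(\<lambda>n. ln (real n) powr (3 * \<beta>) / real n powr (3 * \<beta> - 2))"
proof -
  \<comment> \<open>Ceilings make \<open>k < K1\<close> and \<open>k < K2\<close> exactly the two
    summation ranges; \<open>K2 = 0\<close> if \<open>\<beta> \<le> 2\<close>.\<close>
  define K1 where "K1 = nat \<lceil>2 * \<beta> - 2\<rceil>"
  define K2 where "K2 = nat \<lceil>\<beta> - 2\<rceil>"
  have K1_iff: "real k < 2 * \<beta> - 2 \<longleftrightarrow> k < K1" for k
    unfolding K1_def zless_nat_eq_int_zless less_ceiling_iff by simp
  have K2_iff: "real k < \<beta> - 2 \<longleftrightarrow> k < K2" for k
    unfolding K2_def zless_nat_eq_int_zless less_ceiling_iff by simp
  have K1: "K1 \<ge> 1" "2 * \<beta> - 2 \<le> real K1" "real K1 < 2 * \<beta> - 1"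
    using K1_iff[of 0] K1_iff[of K1] K1_iff[of "K1 - 1"] assms by (auto simp: of_nat_diff)
  have K2: "real K2 < \<beta> - 1" "\<beta> - 2 \<le> real K2"
    using K2_iff[of K2] K2_iff[of "K2 - 1"] assms by (cases K2; simp)+
  \<comment> \<open>Chosen so that
    \<open>(2/3 * c - 1) * (\<beta> - 1) * ln 2 = 3 * \<beta> - 2\<close>; then words with many
    changes contribute at most \<open>n powr (2 - 3 * \<beta>)\<close>.\<close>
  define c where "c = 3/2 * (1 + (3 * \<beta> - 2) / ((\<beta> - 1) * ln 2))"
  have c: "c > 0" using assms by (simp add: c_def add_pos_pos)
  define c1 where "c1 = 2 ^ K1 + 2 ^ K1 * (2 * \<beta> - K1) / (2 * \<beta> - K1 - 1) * 2 powr (2 * \<beta>)"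
  have c1: "c1 \<ge> 0" using K1 by (simp add: c1_def)
  define M where "M = inner_moment \<beta> K2"
  have M: "M \<ge> 0" unfolding M_def inner_moment_def
    by (intro infsum_nonneg) (auto simp: inner_weight_nonneg)
  define D where "D = 2 * 4 powr \<beta> * (2 * c1 + 2 ^ K2 * M) + 2 * (2 * c powr \<beta> * c1 + c powr (2 * \<beta>) * (2 ^ K2 * M)) + 1"
  let ?main = "\<lambda>n. 2 * ((\<Sum>k<K1. coef_last \<beta> k / real n powr (\<beta> + real k)) +
        (\<Sum>k<K2. coef_inner \<beta> k / real n powr (2 * \<beta> + real k)))"
  \<comment> \<open>\<open>n \<ge> 3\<close> ensures \<open>ln n \<ge> 1\<close> and
    \<open>(n - 1) / n \<ge> 2/3\<close>, which is where the 3/2 in \<open>c\<close> comes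
    from.\<close>
  have bound: "\<bar>brocot_sigma \<beta> n - ?main n\<bar> \<le> D * (ln (real n) powr (3 * \<beta>) / real n powr (3 * \<beta> - 2))"
    if n: "n \<ge> 3" for n
  proof -
    define l where "l = ln (real n)"
    define N where "N = real n"
    define P where "P = N powr (2 - 3 * \<beta>)"
    define L where "L = l powr (3 * \<beta>) * P"
    have N: "N \<ge> 3" using n by (simp add: N_def)
    have l: "l \<ge> 1"
    proof -
      have "exp 1 \<le> N" using exp_le N by linarith
      thus ?thesis using N by (simp add: l_def N_def[symmetric] ln_ge_iff)
    qed
    have P: "P > 0" using N by (simp add: P_def)
    have lpow: "l powr x \<le> l powr (3 * \<beta>)" if "x \<le> 3 * \<beta>" for x
      using l that by (intro powr_mono) auto
    have l1: "1 \<le> l powr (3 * \<beta>)" using lpow[of 0] assms l by simp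
    hence PL: "P \<le> L" using P by (simp add: L_def)
    \<comment> \<open>If all blocks are shorter than this, there are about \<open>c * ln n\<close>
      changes, while replacing \<open>n\<close> by \<open>A\<close> in negative powers costs only
      powers of \<open>ln n\<close>.\<close>
    define A where "A = N / (c * l)"
    have A: "A > 0" using N c l by (simp add: A_def)
    have Apow: "A powr - x = N powr - x * (c powr x * l powr x)" for x
      using N c l by (simp add: A_def powr_divide powr_mult powr_minus field_simps)
    define b1 where "b1 = c1 * (N powr (2 - 2 * \<beta>) * (1 + l))"
    define b2 where "b2 = (2 / N) ^ K2 * M"
    have 1: "N powr - \<beta> * b1 = c1 * (1 + l) * P"
    proof -
      have "N powr - \<beta> * N powr (2 - 2 * \<beta>) = P"
        unfolding P_def powr_add[symmetric] by (simp add: algebra_simps)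
      thus ?thesis by (simp add: b1_def mult_ac)
    qed
    have 2: "N powr (- 2 * \<beta>) * b2 \<le> 2 ^ K2 * M * P"
    proof -
      have "N powr (- 2 * \<beta>) * (2 / N) ^ K2 = 2 ^ K2 * N powr (- 2 * \<beta> - real K2)"
        using N by (simp add: power_divide powr_diff powr_realpow)
      also have "\<dots> \<le> 2 ^ K2 * P"
        unfolding P_def using N K2 by (intro mult_left_mono powr_mono) auto
      finally have "N powr (- 2 * \<beta>) * (2 / N) ^ K2 * M \<le> 2 ^ K2 * P * M" using M by (rule mult_right_mono)
      thus ?thesis by (simp add: b2_def mult_ac)
    qed
    have l2: "1 + l \<le> 2 * l powr (3 * \<beta>)" using lpow[of 1] l l1 assms by simp
    have e1: "N powr - \<beta> * b1 \<le> 2 * c1 * L"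
    proof -
      have "c1 * (1 + l) * P \<le> c1 * (2 * l powr (3 * \<beta>)) * P"
        using c1 P l2 by (intro mult_right_mono mult_left_mono) auto
      thus ?thesis unfolding 1 L_def by (simp add: mult_ac)
    qed
    have e2: "N powr (- 2 * \<beta>) * b2 \<le> 2 ^ K2 * M * L"
    proof -
      have "2 ^ K2 * M * P \<le> 2 ^ K2 * M * L" using PL M by (intro mult_left_mono) auto
      thus ?thesis using 2 by linarith
    qed
    \<comment> \<open>\<open>A powr - \<beta>\<close> brings \<open>l powr \<beta>\<close> and
      \<open>b1\<close> one more \<open>l\<close>; the exponent \<open>\<beta> + 1\<close> is at
      most \<open>3 * \<beta>\<close>.\<close>
    have r1: "A powr - \<beta> * b1 \<le> 2 * c powr \<beta> * c1 * L"
    proof -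
      have "l powr \<beta> * (1 + l) \<le> l powr \<beta> * (2 * l powr 1)"
        using l by (intro mult_left_mono) auto
      also have "\<dots> = 2 * l powr (\<beta> + 1)" by (simp add: powr_add)
      also have "\<dots> \<le> 2 * l powr (3 * \<beta>)" using lpow[of "\<beta> + 1"] assms by simp
      finally have "c powr \<beta> * c1 * P * (l powr \<beta> * (1 + l)) \<le> c powr \<beta> * c1 * P * (2 * l powr (3 * \<beta>))"
        using c1 P by (intro mult_left_mono) auto
      moreover have "A powr - \<beta> * b1 = c powr \<beta> * l powr \<beta> * (N powr - \<beta> * b1)"
        unfolding Apow by (simp only: mult_ac)
      ultimately show ?thesis unfolding 1 L_def by (simp add: mult_ac)
    qed
    have r2: "A powr (- 2 * \<beta>) * b2 \<le> c powr (2 * \<beta>) * (2 ^ K2 * M) * L"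
    proof -
      have "A powr (- 2 * \<beta>) * b2 = c powr (2 * \<beta>) * l powr (2 * \<beta>) * (N powr (- 2 * \<beta>) * b2)"
        using Apow[of "2 * \<beta>"] by (simp add: mult_ac)
      also have "\<dots> \<le> c powr (2 * \<beta>) * l powr (3 * \<beta>) * (2 ^ K2 * M * P)"
        using lpow[of "2 * \<beta>"] assms M P N by (intro mult_mono[OF mult_left_mono 2]) (auto simp: b2_def)
      finally show ?thesis by (simp add: L_def mult_ac)
    qed
    have r3: "2 powr - ((real (n - 1) / A - 1) * (\<beta> - 1)) \<le> L"
    proof -
      have "(2/3 * c - 1) * l \<le> 2/3 * c * l - 1" using l by (simp add: algebra_simps)
      also have "2/3 * c * l \<le> real (n - 1) / A"
      proof -
        have "2/3 \<le> (N - 1) / N" using N by (simp add: field_simps)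
        hence "2/3 * (c * l) \<le> (N - 1) / N * (c * l)" using c l by (intro mult_right_mono) auto
        thus ?thesis using n by (simp add: A_def N_def of_nat_diff mult_ac)
      qed
      finally have "(2/3 * c - 1) * l * (\<beta> - 1) \<le> (real (n - 1) / A - 1) * (\<beta> - 1)"
        using assms by (intro mult_right_mono) auto
      moreover have "(2/3 * c - 1) * l * (\<beta> - 1) = (3 * \<beta> - 2) * l / ln 2"
      proof -
        have "2/3 * c - 1 = (3 * \<beta> - 2) / ((\<beta> - 1) * ln 2)"
          unfolding c_def mult.assoc[symmetric] by simp
        thus ?thesis using assms by simp
      qed
      ultimately have "2 powr - ((real (n - 1) / A - 1) * (\<beta> - 1)) \<le> 2 powr - ((3 * \<beta> - 2) * l / ln 2)"
        by (intro powr_mono) auto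
      also have "\<dots> = exp (- ((3 * \<beta> - 2) * l))" unfolding powr_def by simp
      also have "\<dots> = P" using N by (simp add: powr_def P_def l_def N_def algebra_simps)
      finally show ?thesis using PL by linarith
    qed
    have "\<bar>brocot_sigma \<beta> n - ?main n\<bar> \<le>
      2 * 4 powr \<beta> * (N powr - \<beta> * b1 + N powr (- 2 * \<beta>) * b2) +
      2 * (A powr - \<beta> * b1 + A powr (- 2 * \<beta>) * b2) + 2 powr - ((real (n - 1) / A - 1) * (\<beta> - 1))"
      using brocot_sigma_expansion[OF assms K1 K2(1) _ A, of n] n
      unfolding b1_def b2_def c1_def M_def l_def N_def by simp
    also have "\<dots> \<le> 2 * 4 powr \<beta> * (2 * c1 * L + 2 ^ K2 * M * L) +
      2 * (2 * c powr \<beta> * c1 * L + c powr (2 * \<beta>) * (2 ^ K2 * M) * L) + L"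
      by (intro add_mono mult_left_mono e1 e2 r1 r2 r3) auto
    also have "\<dots> = D * L" by (simp add: D_def algebra_simps)
    also have "L = l powr (3 * \<beta>) / N powr (3 * \<beta> - 2)"
      using powr_minus_divide[of N "3 * \<beta> - 2"] by (simp add: L_def P_def)
    finally show ?thesis unfolding l_def N_def .
  qed
  \<comment> \<open>The factor 2 counts complementary words.\<close>
  define C where "C = (\<lambda>k. 2 * coef_last \<beta> k)"
  define C' where "C' = (\<lambda>k. 2 * coef_inner \<beta> k)"
  have sets: "{k. 1 \<le> k \<and> real k < 2 * \<beta> - 2} = {1..<K1}" "{k. real k < \<beta> - 2} = {..<K2}"
    by (auto simp: K1_iff K2_iff)
  have main: "1 / real n powr \<beta> * (2 * zeta (2 * \<beta> - 1) / zeta (2 * \<beta>))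
         + (\<Sum>k | 1 \<le> k \<and> real k < 2 * \<beta> - 2. C k * (1 / real n powr (\<beta> + real k)))
         + (\<Sum>k | real k < \<beta> - 2. C' k * (1 / real n powr (2 * \<beta> + real k))) = ?main n" for n
  proof -
    \<comment> \<open>The term \<open>k = 0\<close> is split off, as it carries the zeta
      values.\<close>
    have "(\<Sum>k<K1. coef_last \<beta> k / real n powr (\<beta> + real k)) =
       coef_last \<beta> 0 / real n powr \<beta> + (\<Sum>k = 1..<K1. coef_last \<beta> k / real n powr (\<beta> + real k))"
      unfolding lessThan_atLeast0 using K1(1) by (subst sum.atLeast_Suc_lessThan) auto
    thus ?thesis unfolding sets C_def C'_def coef_last_0[OF assms]
      by (simp add: sum_distrib_left algebra_simps)
  qed
  have "(\<forall>k. 1 \<le> k \<and> real k < 2 * \<beta> - 2 \<longrightarrow> C k > 0)" using coef_last_pos assms by (simp add: C_def)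
  moreover have "(\<forall>k. real k < \<beta> - 2 \<longrightarrow> C' k > 0)" using coef_inner_pos assms by (simp add: C'_def)
  moreover have "(\<lambda>n. brocot_sigma \<beta> n - ?main n) \<in> O(\<lambda>n. ln (real n) powr (3 * \<beta>) / real n powr (3 * \<beta> - 2))"
    by (rule bigoI[where c = D], rule eventually_mono[OF eventually_ge_at_top[of 3]]) (use bound in simp)
  ultimately show ?thesis unfolding main[symmetric] by blast
qed

end
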